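(* Let $\Omega\subset\mathbb{R}^n$ be a domain, $1<p<\infty$, and let $\mathcal{A}=\sum_{j=1}^nA_j\partial_j$ be a homogeneous first order operator with constant coefficients $A_j\in\mathcal{L}(E,F)$. Let $u\in\operatorname{dom}_{p,\Omega}(\mathcal{A}_w)$. Assume that $u$ has a weak $L^p$ spherical blow up limit $u_{\mathcal{A},S}(x,\cdot)$ adapted to $\mathcal{A}$ at $x\in\Omega$, and that $x$ is a $p$-Lebesgue point of $\mathcal{A}_wu$. Then $$\operatorname*{ess\,lim}_{\varepsilon\to0^+}\frac1\varepsilon\int_{S^{n-1}}\mathbb{A}(\xi)u(x+\varepsilon\xi)\,d\sigma(\xi)$$ $$=\operatorname*{ess\,lim}_{\varepsilon\to0^+}\int_{S^{n-1}}\mathbb{A}(\eta)\left[\frac1{\omega_n}\int_{S^{n-1}}\Big(\mathbb{A}(\xi)^+\mathbb{A}(\xi)\frac{u(x+\varepsilon\xi)-u_{\mathcal{A},S}(x,\xi)}{\varepsilon}\Big)\otimes\xi\,d\sigma(\xi)\right](\eta)\,d\sigma(\eta).$$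
   Context: $E,F$ are finite-dimensional real Euclidean vector spaces, $\mathcal{L}(V,W)$ the linear maps $V\to W$; $\mathbb{A}(\xi)=\sum_j\xi_jA_j$; $\mathbb{A}(\xi)^+\in\mathcal{L}(F,E)$ is the Moore–Penrose pseudoinverse, so $\mathbb{A}(\xi)^+\mathbb{A}(\xi)$ is the orthogonal projection onto $(\ker\mathbb{A}(\xi))^\perp$. For $a\in E$, $\xi\in\mathbb{R}^n$: $(a\otimes\xi)(\eta)=\langle\xi,\eta\rangle a$. $\sigma$ is surface measure on $S^{n-1}$, $\omega_n=|B_1(0)|$. $u\in L^p(\Omega,E)$ is in $\operatorname{dom}_{p,\Omega}(\mathcal{A}_w)$ if its distributional image $\mathcal{A}u$ is a function $\mathcal{A}_wu\in L^p(\Omega,F)$. Ess lim means the limit along $\varepsilon$ outside some Lebesgue null set. $u$ has a weak $L^p$ spherical blow up limit adapted to $\mathcal{A}$ at $x$ if there is $v\in L^p(S^{n-1},\sigma;E)$, denoted $u_{\mathcal{A},S}(x,\cdot)$, with $\mathbb{A}(\xi)^+\mathbb{A}(\xi)u(x+\varepsilon\xi)\rightharpoonup v(\xi)$ weakly in $L^p(S^{n-1},E)$ as $\varepsilon\to0^+$ outside some null set of $\varepsilon$. The point $x$ is a $p$-Lebesgue point of $f\in L^p_{loc}$ if $\lim_{r\to0^+}|B_r(x)|^{-1}\int_{B_r(x)}|f(y)-f^\star(x)|^p\,dy=0$, where $f^\star(x)=\lim_{r\to0^+}|B_r(x)|^{-1}\int_{B_r(x)}f\,dy$. *)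

theory Defs
  imports "HOL-Analysis.Analysis"
begin

text \<open>The Bochner integral of maps into \<open>'a \<Rightarrow>\<^sub>L 'b\<close> requires this instance.\<close>

instance blinfun :: (euclidean_space, euclidean_space) second_countable_topology
proof
  have "\<exists>K. finite K \<and> cball (0::'a \<Rightarrow>\<^sub>L 'b) (real n) \<subseteq> (\<Union>x\<in>K. ball x (1 / real (Suc k)))"
    for n k
    using seq_compact_imp_totally_bounded[of "cball (0::'a \<Rightarrow>\<^sub>L 'b) (real n)"]
      compact_cball[of "0::'a \<Rightarrow>\<^sub>L 'b" "real n"]
    by (metis compact_imp_seq_compact of_nat_0_less_iff zero_less_Suc zero_less_divide_1_iff)
  then obtain K where K: "\<And>n k. finite (K n k)"
    "\<And>n k. cball (0::'a \<Rightarrow>\<^sub>L 'b) (real n) \<subseteq> (\<Union>x\<in>K n k. ball x (1 / real (Suc k)))"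
    by metis
  let ?B = "\<Union>n k. (\<lambda>x. ball x (1 / real (Suc k))) ` K n k"
  have "countable ?B"
    by (intro countable_UN countable_image countableI_type countable_finite K(1))
  moreover have "topological_basis ?B"
  proof (rule topological_basisI)
    fix U and x :: "'a \<Rightarrow>\<^sub>L 'b"
    assume "open U" "x \<in> U"
    then obtain e where e: "e > 0" "ball x e \<subseteq> U"
      by (meson open_contains_ball)
    obtain k where k: "1 / real (Suc k) < e / 2"
      using e(1) nat_approx_posE[of "e / 2"] by (metis half_gt_zero)
    obtain n where "norm x \<le> real n"
      using real_arch_simple by blast
    then have "x \<in> cball 0 (real n)" by simp
    then obtain d where d: "d \<in> K n k" "x \<in> ball d (1 / real (Suc k))"
      using K(2)[of n k] by blast
    have "ball d (1 / real (Suc k)) \<subseteq> ball x e"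
    proof
      fix y assume "y \<in> ball d (1 / real (Suc k))"
      then have "dist d y < e / 2" "dist d x < e / 2"
        using d(2) k by (auto simp del: of_nat_Suc)
      then show "y \<in> ball x e"
        using dist_triangle3[of x y d] by (simp del: of_nat_Suc)
    qed
    then show "\<exists>V\<in>?B. x \<in> V \<and> V \<subseteq> U"
      using d e(2) by (intro bexI[of _ "ball d (1 / real (Suc k))"]) auto
  qed auto
  ultimately show "\<exists>B::('a \<Rightarrow>\<^sub>L 'b) set set. countable B \<and> open = generate_topology B"
    using topological_basis_imp_subbasis by blast
qed

text \<open>The Moore--Penrose pseudoinverse, given by the four Penrose conditions.\<close>

definition pinv :: "('a::euclidean_space \<Rightarrow>\<^sub>L 'b::euclidean_space) \<Rightarrow> ('b \<Rightarrow>\<^sub>L 'a)" where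
  "pinv T = (THE S. T o\<^sub>L S o\<^sub>L T = T \<and> S o\<^sub>L T o\<^sub>L S = S \<and>
     (\<forall>y z. (T o\<^sub>L S) y \<bullet> z = y \<bullet> (T o\<^sub>L S) z) \<and>
     (\<forall>y z. (S o\<^sub>L T) y \<bullet> z = y \<bullet> (S o\<^sub>L T) z))"

definition symbol :: "('n::finite \<Rightarrow> 'e::euclidean_space \<Rightarrow>\<^sub>L 'f::euclidean_space) \<Rightarrow> real^'n \<Rightarrow> 'e \<Rightarrow>\<^sub>L 'f"
  where "symbol A \<xi> = (\<Sum>j\<in>UNIV. (\<xi> $ j) *\<^sub>R A j)"

lift_definition tensor :: "'e::euclidean_space \<Rightarrow> real^'n \<Rightarrow> ((real^'n) \<Rightarrow>\<^sub>L 'e)"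
  is "\<lambda>a \<xi> \<eta>. (\<xi> \<bullet> \<eta>) *\<^sub>R a"
  by (intro bounded_linear_intros)

text \<open>Surface measure of the unit sphere, as the cone measure
  \<open>\<sigma>(B) = n \<cdot> |{t b | 0 < t \<le> 1, b \<in> B}|\<close>, which is what integration in polar coordinates
  requires. It is completed because the restriction of a Lebesgue measurable function to almost
  every sphere is in general only measurable for the completion.\<close>

definition surface_measure :: "(real^'n) measure" where
  "surface_measure = completion (scale_measure (of_nat CARD('n))
     (distr (restrict_space lborel (cball 0 1 - {0})) (restrict_space borel (sphere 0 1)) sgn))"

lemma emeasure_surface_measure:
  fixes B :: "(real^'n) set"
  assumes "B \<in> sets borel" "B \<subseteq> sphere 0 1"
  shows "emeasure surface_measure B
    = of_nat CARD('n) * emeasure lborel {t *\<^sub>R b | t b. 0 < t \<and> t \<le> 1 \<and> b \<in> B}"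
proof -
  let ?R = "restrict_space lborel (cball 0 1 - {0::real^'n})"
  let ?S = "restrict_space borel (sphere 0 (1::real)) :: (real^'n) measure"
  have sgn: "sgn \<in> ?R \<rightarrow>\<^sub>M ?S"
  proof (rule measurable_restrict_space2)
    show "sgn \<in> space ?R \<rightarrow> sphere 0 1"
      by (auto simp: space_restrict_space norm_sgn)
    have "(sgn :: real^'n \<Rightarrow> _) \<in> borel_measurable borel"
      unfolding sgn_div_norm by measurable
    then show "sgn \<in> borel_measurable ?R"
      by (simp add: measurable_restrict_space1)
  qed
  have B: "B \<in> sets ?S"
    using assms by (auto simp: sets_restrict_space image_iff intro!: bexI[of _ B])
  have eq: "sgn -` B \<inter> space ?R = {t *\<^sub>R b | t b. 0 < t \<and> t \<le> 1 \<and> b \<in> B}" (is "?L = ?C")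
  proof
    show "?L \<subseteq> ?C"
    proof
      fix y assume "y \<in> ?L"
      then have "y = norm y *\<^sub>R sgn y" "0 < norm y" "norm y \<le> 1" "sgn y \<in> B"
        by (auto simp: space_restrict_space sgn_div_norm)
      then show "y \<in> ?C" by blast
    qed
    show "?C \<subseteq> ?L"
      using assms(2) by (auto simp: space_restrict_space sgn_div_norm subset_iff)
  qed
  have "emeasure surface_measure B = of_nat CARD('n) * emeasure (distr ?R ?S sgn) B"
    using B by (simp add: surface_measure_def emeasure_completion)
  also have "emeasure (distr ?R ?S sgn) B = emeasure ?R ?C"
    using emeasure_distr[OF sgn B] eq by simp
  also have "\<dots> = emeasure lborel ?C"
    by (rule emeasure_restrict_space) (auto simp: eq[symmetric] space_restrict_space)
  finally show ?thesis .
qed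

definition in_Lp :: "real \<Rightarrow> 'a measure \<Rightarrow> ('a \<Rightarrow> 'b::euclidean_space) \<Rightarrow> bool" where
  "in_Lp p M f \<longleftrightarrow> f \<in> borel_measurable M \<and> integrable M (\<lambda>x. norm (f x) powr p)"

text \<open>Weak convergence in \<open>L\<^sup>p(M)\<close>, \<open>1 < p < \<infinity>\<close>, along a filter; the dual of \<open>L\<^sup>p\<close> is \<open>L\<^sup>q\<close> with
  \<open>q = p / (p - 1)\<close>.\<close>

definition weakly_tendsto_Lp ::
  "real \<Rightarrow> 'a measure \<Rightarrow> ('i \<Rightarrow> 'a \<Rightarrow> 'b::euclidean_space) \<Rightarrow> ('a \<Rightarrow> 'b) \<Rightarrow> 'i filter \<Rightarrow> bool" where
  "weakly_tendsto_Lp p M f g F \<longleftrightarrow>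
     in_Lp p M g \<and> (\<forall>\<^sub>F i in F. in_Lp p M (f i)) \<and>
     (\<forall>h. in_Lp (p / (p - 1)) M h \<longrightarrow>
        ((\<lambda>i. LINT x|M. f i x \<bullet> h x) \<longlongrightarrow> (LINT x|M. g x \<bullet> h x)) F)"

definition partial_deriv :: "'n \<Rightarrow> (real^'n \<Rightarrow> real) \<Rightarrow> real^'n \<Rightarrow> real" where
  "partial_deriv j \<phi> x = frechet_derivative \<phi> (at x) (axis j 1)"

primrec C_k :: "nat \<Rightarrow> (real^'n \<Rightarrow> real) \<Rightarrow> bool" where
  "C_k 0 \<phi> \<longleftrightarrow> continuous_on UNIV \<phi>"
| "C_k (Suc k) \<phi> \<longleftrightarrow> (\<forall>x. \<phi> differentiable at x) \<and> (\<forall>j. C_k k (partial_deriv j \<phi>))"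

definition test_function :: "(real^'n) set \<Rightarrow> (real^'n \<Rightarrow> real) \<Rightarrow> bool" where
  "test_function \<Omega> \<phi> \<longleftrightarrow>
     (\<forall>k. C_k k \<phi>) \<and> compact (closure {x. \<phi> x \<noteq> 0}) \<and> closure {x. \<phi> x \<noteq> 0} \<subseteq> \<Omega>"

text \<open>\<open>w\<close> is a representative of \<open>\<A>\<^sub>w u\<close>: it lies in \<open>L\<^sup>p(\<Omega>, F)\<close> and equals
  \<open>\<Sum>\<^sub>j A\<^sub>j \<partial>\<^sub>j u\<close> as an \<open>F\<close>-valued distribution on \<open>\<Omega>\<close>.\<close>

definition weak_image ::
  "real \<Rightarrow> (real^'n) set \<Rightarrow> ('n::finite \<Rightarrow> 'e::euclidean_space \<Rightarrow>\<^sub>L 'f::euclidean_space)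
    \<Rightarrow> (real^'n \<Rightarrow> 'e) \<Rightarrow> (real^'n \<Rightarrow> 'f) \<Rightarrow> bool" where
  "weak_image p \<Omega> A u w \<longleftrightarrow> in_Lp p (lebesgue_on \<Omega>) w \<and>
     (\<forall>\<phi>. test_function \<Omega> \<phi> \<longrightarrow>
        (LINT y|lebesgue_on \<Omega>. \<phi> y *\<^sub>R w y)
          = - (LINT y|lebesgue_on \<Omega>. (\<Sum>j\<in>UNIV. partial_deriv j \<phi> y *\<^sub>R A j (u y))))"

definition weak_dom ::
  "real \<Rightarrow> (real^'n) set \<Rightarrow> ('n::finite \<Rightarrow> 'e::euclidean_space \<Rightarrow>\<^sub>L 'f::euclidean_space)
    \<Rightarrow> (real^'n \<Rightarrow> 'e) set" where
  "weak_dom p \<Omega> A = {u. in_Lp p (lebesgue_on \<Omega>) u \<and> (\<exists>w. weak_image p \<Omega> A u w)}"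

definition ess_lim_0 :: "(real \<Rightarrow> 'a::topological_space) \<Rightarrow> 'a \<Rightarrow> bool" where
  "ess_lim_0 f L \<longleftrightarrow> (\<exists>N\<in>null_sets lebesgue. (f \<longlongrightarrow> L) (at 0 within {0<..} - N))"

text \<open>\<open>v\<close> is a representative of the weak \<open>L\<^sup>p\<close> spherical blow up limit of \<open>u\<close> at \<open>x\<close>
  adapted to the operator.\<close>

definition weak_spherical_blowup ::
  "real \<Rightarrow> ('n::finite \<Rightarrow> 'e::euclidean_space \<Rightarrow>\<^sub>L 'f::euclidean_space)
    \<Rightarrow> (real^'n \<Rightarrow> 'e) \<Rightarrow> real^'n \<Rightarrow> (real^'n \<Rightarrow> 'e) \<Rightarrow> bool" where
  "weak_spherical_blowup p A u x v \<longleftrightarrow>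
     (\<exists>N\<in>null_sets lebesgue.
        weakly_tendsto_Lp p surface_measure
          (\<lambda>\<epsilon> \<xi>. (pinv (symbol A \<xi>) o\<^sub>L symbol A \<xi>) (u (x + \<epsilon> *\<^sub>R \<xi>))) v
          (at 0 within {0<..} - N))"

text \<open>The limit \<open>c\<close> of the means is the value \<open>f\<^sup>\<star>(x)\<close> of the precise representative.\<close>

definition Lebesgue_point :: "real \<Rightarrow> (real^'n \<Rightarrow> 'f::euclidean_space) \<Rightarrow> real^'n \<Rightarrow> bool" where
  "Lebesgue_point p f x \<longleftrightarrow>
     (\<exists>c. ((\<lambda>r. (1 / measure lebesgue (ball x r)) *\<^sub>R (LINT y|lebesgue_on (ball x r). f y)) \<longlongrightarrow> c)
            (at_right 0) \<and>
          ((\<lambda>r. (1 / measure lebesgue (ball x r))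
                  * (LINT y|lebesgue_on (ball x r). norm (f y - c) powr p)) \<longlongrightarrow> 0)
            (at_right 0))"

end

theory Submission
  imports Defs
begin

text \<open>
  Let \<open>c\<close> be the value of the precise representative of \<open>\<A>\<^sub>w u\<close> at \<open>x\<close> and let \<open>\<omega>\<close> be the volume of
  the unit ball. Both limits exist and equal \<open>\<omega> c\<close>.

  The first one is the divergence theorem. Testing the weak equation with functions that depend only
  on the distance to \<open>x\<close> and passing to polar coordinates yields, for almost every small \<open>r\<close>,
  \<open>r\<^sup>n\<^sup>-\<^sup>1 \<integral> \<A>(\<xi>) u(x + r \<xi>) d\<sigma>(\<xi>) = \<integral> \<A>\<^sub>w u\<close> with the right-hand integral over the ball of radius \<open>r\<close>
  around \<open>x\<close> (\<open>sphere_mean_eq_ball_integral\<close>). Dividing by \<open>r\<^sup>n\<close> and using that \<open>x\<close> is a Lebesgue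
  point gives the limit \<open>\<omega> c\<close>.

  The second expression is, for almost every small \<open>\<epsilon>\<close>, literally equal to the first. The moments
  \<open>\<integral> \<eta>\<^sub>j \<eta>\<^sub>k d\<sigma>(\<eta>) = \<omega> \<delta>\<^sub>j\<^sub>k\<close> show that replacing a field \<open>b\<close> on the sphere by its tensor average
  \<open>1/\<omega> \<integral> b(\<xi>) \<otimes> \<xi> d\<sigma>(\<xi>)\<close> and integrating \<open>\<A>(\<eta>)\<close> of that linear map returns \<open>\<integral> \<A>(\<xi>) b(\<xi>) d\<sigma>(\<xi>)\<close>
  (\<open>sphere_integral_tensor_mean\<close>). Since \<open>\<A>(\<xi>) \<A>(\<xi>)\<^sup>+ \<A>(\<xi>) = \<A>(\<xi>)\<close>, the second expression is
  therefore \<open>1/\<epsilon> \<integral> \<A>(\<xi>) (u(x + \<epsilon> \<xi>) - v(\<xi>)) d\<sigma>(\<xi>)\<close>. It remains to see that \<open>v\<close> contributes nothing: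
  pairing the weak convergence with the bounded fields \<open>\<A>(\<xi>)\<^sup>* f\<close> identifies \<open>\<integral> \<A>(\<xi>) v(\<xi>) d\<sigma>(\<xi>)\<close> as
  the limit of \<open>\<integral> \<A>(\<xi>) u(x + \<epsilon> \<xi>) d\<sigma>(\<xi>)\<close>, and this is \<open>\<epsilon>\<close> times a convergent quantity
  (\<open>integral_symbol_blowup_eq_0\<close>).

  For the Bochner integrals to be meaningful, the projection \<open>\<A>(\<xi>)\<^sup>+ \<A>(\<xi>)\<close> has to depend measurably on
  \<open>\<xi>\<close>, although its rank can jump. Its complement has norm \<open>dist(e, range \<A>(\<xi>)\<^sup>*)\<close> at \<open>e\<close>, an infimum of
  continuous functions of \<open>\<xi>\<close>, and the projection itself is recovered by polarization
  (\<open>borel_measurable_row_projection_symbol\<close>).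
\<close>

section \<open>The Moore--Penrose inverse and the row space\<close>

definition penrose :: "('a::euclidean_space \<Rightarrow>\<^sub>L 'b::euclidean_space) \<Rightarrow> ('b \<Rightarrow>\<^sub>L 'a) \<Rightarrow> bool" where
  "penrose T S \<longleftrightarrow> T o\<^sub>L S o\<^sub>L T = T \<and> S o\<^sub>L T o\<^sub>L S = S \<and>
     (\<forall>y z. (T o\<^sub>L S) y \<bullet> z = y \<bullet> (T o\<^sub>L S) z) \<and>
     (\<forall>y z. (S o\<^sub>L T) y \<bullet> z = y \<bullet> (S o\<^sub>L T) z)"

lemma orthogonal_projection_exists:
  fixes V :: "'a::euclidean_space set"
  assumes "subspace V"
  obtains Q where "linear Q" "\<And>y. Q y \<in> V" "\<And>y. y \<in> V \<Longrightarrow> Q y = y" "\<And>y z. Q y \<bullet> z = y \<bullet> Q z"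
proof -
  obtain B where B: "B \<subseteq> V" "pairwise orthogonal B" "\<And>b. b \<in> B \<Longrightarrow> norm b = 1"
    "independent B" "span B = V"
    using orthonormal_basis_subspace[OF assms] by metis
  have fin: "finite B" using B(4) by (rule independent_imp_finite)
  define Q where "Q y = (\<Sum>b\<in>B. (y \<bullet> b) *\<^sub>R b)" for y
  have lin: "linear Q"
    unfolding Q_def by (rule linearI)
      (simp_all add: inner_add_left scaleR_add_left sum.distrib scaleR_sum_right)
  have QV: "Q y \<in> V" for y
    unfolding Q_def using B assms by (auto intro!: subspace_sum subspace_scale)
  have "Q b = b" if "b \<in> B" for b
  proof -
    have "(b \<bullet> b') *\<^sub>R b' = (if b' = b then b else 0)" if "b' \<in> B" for b'
      using B(2,3) \<open>b \<in> B\<close> that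
      by (auto simp: pairwise_def orthogonal_def norm_eq_1)
    then have "Q b = (\<Sum>b'\<in>B. if b' = b then b else 0)"
      unfolding Q_def by (intro sum.cong) auto
    then show ?thesis using fin that by simp
  qed
  then have "Q y = y" if "y \<in> V" for y
    using linear_eq_on[OF lin linear_id] that B(5) by auto
  moreover have "Q y \<bullet> z = y \<bullet> Q z" for y z
    unfolding Q_def inner_sum_left inner_sum_right
    by (intro sum.cong) (auto simp: inner_commute)
  ultimately show thesis using that lin QV by blast
qed

text \<open>With orthogonal projections \<open>Q\<close> onto the range and \<open>K\<close> onto the kernel of \<open>T\<close>, and a linear right
  inverse \<open>g\<close> of \<open>T\<close> on its range, the Moore--Penrose inverse is \<open>(1 - K) g Q\<close>.\<close>

lemma penrose_exists:
  fixes T :: "'a::euclidean_space \<Rightarrow>\<^sub>L 'b::euclidean_space"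
  shows "\<exists>S. penrose T S"
proof -
  have linT: "linear (blinfun_apply T)"
    by (rule bounded_linear.linear[OF blinfun.bounded_linear_right])
  define R where "R = range (blinfun_apply T)"
  define N where "N = {y. T y = 0}"
  have "subspace R" "subspace N"
    unfolding R_def N_def using linear_subspace_image[OF linT subspace_UNIV]
      linear_subspace_kernel[OF linT] by auto
  obtain Q where Q: "linear Q" "\<And>y. Q y \<in> R" "\<And>y. y \<in> R \<Longrightarrow> Q y = y" "\<And>y z. Q y \<bullet> z = y \<bullet> Q z"
    using orthogonal_projection_exists[OF \<open>subspace R\<close>] by blast
  obtain K where K: "linear K" "\<And>y. K y \<in> N" "\<And>y. y \<in> N \<Longrightarrow> K y = y" "\<And>y z. K y \<bullet> z = y \<bullet> K z"
    using orthogonal_projection_exists[OF \<open>subspace N\<close>] by blast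
  obtain g where g: "linear g" "\<And>y. y \<in> R \<Longrightarrow> T (g y) = y"
    using linear_exists_right_inverse_on[OF linT subspace_UNIV] unfolding R_def by auto
  define h where "h y = g (Q y) - K (g (Q y))" for y
  have "linear h"
    unfolding h_def
    by (rule linearI) (simp_all add: linear_add[OF Q(1)] linear_add[OF K(1)] linear_add[OF g(1)]
        linear_scale[OF Q(1)] linear_scale[OF K(1)] linear_scale[OF g(1)] scaleR_diff_right)
  then have bh: "bounded_linear h"
    by (rule linear_conv_bounded_linear[THEN iffD1])
  define S where "S = Blinfun h"
  have S: "blinfun_apply S y = h y" for y
    unfolding S_def by (simp add: bounded_linear_Blinfun_apply bh)
  have TK: "T (K y) = 0" for y
    using K(2) by (simp add: N_def)
  have TS: "T (S y) = Q y" for y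
    by (simp add: S h_def blinfun.diff_right TK g(2) Q(2))
  have ST: "S (T y) = y - K y" for y
  proof -
    have Qy: "Q (T y) = T y" by (rule Q(3)) (simp add: R_def)
    have "g (T y) - y \<in> N"
      by (simp add: N_def blinfun.diff_right g(2) R_def)
    then have "K (g (T y) - y) = g (T y) - y" by (rule K(3))
    then show ?thesis
      by (simp add: S h_def Qy linear_diff[OF K(1)] algebra_simps)
  qed
  have "T o\<^sub>L S o\<^sub>L T = T"
    by (rule blinfun_eqI) (simp add: ST blinfun.diff_right TK)
  moreover have "S o\<^sub>L T o\<^sub>L S = S"
  proof (rule blinfun_eqI)
    have "K (K y) = K y" for y by (rule K(3)[OF K(2)])
    then show "(S o\<^sub>L T o\<^sub>L S) y = S y" for y
      by (simp add: ST) (simp add: S h_def linear_diff[OF K(1)])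
  qed
  moreover have "\<forall>y z. (T o\<^sub>L S) y \<bullet> z = y \<bullet> (T o\<^sub>L S) z"
    by (simp add: TS Q(4))
  moreover have "\<forall>y z. (S o\<^sub>L T) y \<bullet> z = y \<bullet> (S o\<^sub>L T) z"
    by (simp add: ST K(4) inner_diff_left inner_diff_right)
  ultimately show ?thesis unfolding penrose_def by blast
qed

text \<open>Two orthogonal projections with the same range coincide: \<open>T S = (T S') (T S)\<close>, and taking adjoints
  turns the right-hand side into \<open>(T S) (T S') = T S'\<close>. The same argument gives \<open>S T = S' T\<close>, and then
  \<open>S = S T S = S' T S'\<close>.\<close>

lemma penrose_unique:
  fixes T :: "'a::euclidean_space \<Rightarrow>\<^sub>L 'b::euclidean_space"
  assumes "penrose T S" "penrose T S'"
  shows "S = S'"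
proof -
  have T: "T (S (T y)) = T y" "T (S' (T y)) = T y" for y
    using assms unfolding penrose_def by (metis blinfun_apply_blinfun_compose)+
  have S: "S (T (S y)) = S y" "S' (T (S' y)) = S' y" for y
    using assms unfolding penrose_def by (metis blinfun_apply_blinfun_compose)+
  have TS: "T (S y) \<bullet> z = y \<bullet> T (S z)" "T (S' y) \<bullet> z = y \<bullet> T (S' z)" for y z
    using assms unfolding penrose_def by simp_all
  have ST: "S (T y) \<bullet> z = y \<bullet> S (T z)" "S' (T y) \<bullet> z = y \<bullet> S' (T z)" for y z
    using assms unfolding penrose_def by simp_all
  have 1: "T (S y) = T (S' y)" for y
  proof -
    have "T (S y) \<bullet> z = T (S' y) \<bullet> z" for z
      by (metis T TS)
    then show ?thesis by (metis vector_eq_rdot)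
  qed
  have 2: "S (T y) = S' (T y)" for y
  proof -
    have "S (T y) \<bullet> z = S' (T y) \<bullet> z" for z
      by (metis T ST)
    then show ?thesis by (metis vector_eq_rdot)
  qed
  show ?thesis
    by (rule blinfun_eqI) (metis S 1 2)
qed

lemma penrose_pinv: "penrose T (pinv T)"
proof -
  have "\<exists>!S. penrose T S" using penrose_exists penrose_unique by blast
  then have "penrose T (THE S. penrose T S)" by (rule theI')
  then show ?thesis unfolding pinv_def penrose_def .
qed

text \<open>The orthogonal projection onto the orthogonal complement of the kernel of \<open>T\<close>, which is the range of
  the adjoint of \<open>T\<close> (the row space).\<close>

definition row_projection :: "('a::euclidean_space \<Rightarrow>\<^sub>L 'b::euclidean_space) \<Rightarrow> 'a \<Rightarrow>\<^sub>L 'a" where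
  "row_projection T = pinv T o\<^sub>L T"

lemma apply_row_projection [simp]: "T (row_projection T e) = T e"
  using penrose_pinv[of T] unfolding penrose_def row_projection_def
  by (metis blinfun_apply_blinfun_compose)

lemma row_projection_symmetric: "row_projection T e \<bullet> d = e \<bullet> row_projection T d"
  using penrose_pinv[of T] unfolding penrose_def row_projection_def by blast

lemma row_projection_idem [simp]: "row_projection T (row_projection T e) = row_projection T e"
  using penrose_pinv[of T] unfolding penrose_def row_projection_def
  by (metis blinfun_apply_blinfun_compose)

lemma norm_row_projection_le: "norm (row_projection T e) \<le> norm e"
proof -
  have "row_projection T e \<bullet> row_projection T e = e \<bullet> row_projection T e"
    by (simp add: row_projection_symmetric)
  also have "\<dots> \<le> norm e * norm (row_projection T e)" by (rule norm_cauchy_schwarz)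
  finally have "norm (row_projection T e) * norm (row_projection T e) \<le> norm e * norm (row_projection T e)"
    by (simp add: power2_norm_eq_inner[symmetric] power2_eq_square)
  then show ?thesis
    by (cases "row_projection T e = 0") auto
qed

text \<open>The projection maps \<open>e\<close> to the nearest point of the row space, because \<open>e - row_projection T e\<close> lies in
  the kernel of \<open>T\<close>, which is orthogonal to the row space.\<close>

lemma row_projection_dist_le: "norm (e - row_projection T e) \<le> norm (e - adjoint T y)"
proof -
  have linT: "linear (blinfun_apply T)"
    by (rule bounded_linear.linear[OF blinfun.bounded_linear_right])
  let ?k = "e - row_projection T e"
  have "?k \<bullet> (row_projection T e - adjoint T y) = 0"
  proof -
    have "?k \<bullet> row_projection T e = 0"
      by (simp add: inner_diff_left row_projection_symmetric)
    moreover have "?k \<bullet> adjoint T y = 0"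
      by (simp add: adjoint_works[OF linT] blinfun.diff_right)
    ultimately show ?thesis by (simp add: inner_diff_right)
  qed
  then have "norm (?k + (row_projection T e - adjoint T y)) ^ 2
      = norm ?k ^ 2 + norm (row_projection T e - adjoint T y) ^ 2"
    by (intro norm_add_Pythagorean) (simp add: orthogonal_def)
  then have "norm ?k ^ 2 \<le> norm (e - adjoint T y) ^ 2" by simp
  then show ?thesis by (rule power2_le_imp_le) simp
qed

lemma row_projection_in_row_space: "\<exists>y. row_projection T e = adjoint T y"
proof -
  have linT: "linear (blinfun_apply T)" and linS: "linear (blinfun_apply (pinv T))"
    by (rule bounded_linear.linear[OF blinfun.bounded_linear_right])+
  have "row_projection T e \<bullet> d = adjoint T (adjoint (pinv T) e) \<bullet> d" for d
    by (simp add: adjoint_clauses[OF linT] adjoint_clauses[OF linS] row_projection_symmetric)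
      (simp add: row_projection_def)
  then show ?thesis by (metis vector_eq_rdot)
qed

section \<open>Measurable dependence of the row space projection on the frequency\<close>

lemma linear_symbol: "linear (blinfun_apply (symbol A \<xi>))"
  by (rule bounded_linear.linear[OF blinfun.bounded_linear_right])

lemma symbol_apply: "symbol A \<xi> e = (\<Sum>j\<in>UNIV. (\<xi> $ j) *\<^sub>R A j e)"
  unfolding symbol_def by (simp add: blinfun.sum_left blinfun.scaleR_left)

lemma adjoint_symbol: "adjoint (symbol A \<xi>) y = (\<Sum>j\<in>UNIV. (\<xi> $ j) *\<^sub>R adjoint (A j) y)"
proof -
  have linA: "linear (blinfun_apply (A j))" for j
    by (rule bounded_linear.linear[OF blinfun.bounded_linear_right])
  have "adjoint (symbol A \<xi>) y \<bullet> d = (\<Sum>j\<in>UNIV. (\<xi> $ j) *\<^sub>R adjoint (A j) y) \<bullet> d" for d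
    by (simp add: adjoint_clauses[OF linear_symbol] adjoint_clauses[OF linA] symbol_apply
        inner_sum_right inner_sum_left)
  then show ?thesis by (metis vector_eq_rdot)
qed

lemma continuous_adjoint_symbol: "continuous_on X (\<lambda>\<xi>. adjoint (symbol A \<xi>) y)"
  unfolding adjoint_symbol by (intro continuous_intros)

text \<open>The distance of \<open>e\<close> to the row space is below \<open>c\<close> iff some \<open>y\<close> satisfies \<open>norm (e - \<A>(\<xi>)\<^sup>* y) < c\<close>, which
  is an open condition on \<open>\<xi>\<close> for every \<open>y\<close>. So the distance is upper semicontinuous in \<open>\<xi>\<close>.\<close>

lemma borel_measurable_symbol_kernel_norm:
  "(\<lambda>\<xi>. norm (e - row_projection (symbol A \<xi>) e)) \<in> borel_measurable borel"
proof (rule borel_measurableI_less)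
  fix c :: real
  have "{\<xi>. norm (e - row_projection (symbol A \<xi>) e) < c}
      = (\<Union>y. {\<xi>. norm (e - adjoint (symbol A \<xi>) y) < c})"
    (is "?L = ?R")
  proof
    show "?L \<subseteq> ?R"
    proof
      fix \<xi> assume "\<xi> \<in> ?L"
      moreover obtain y where "row_projection (symbol A \<xi>) e = adjoint (symbol A \<xi>) y"
        using row_projection_in_row_space by blast
      ultimately show "\<xi> \<in> ?R" by auto
    qed
    show "?R \<subseteq> ?L"
      using row_projection_dist_le order.strict_trans1 by blast
  qed
  moreover have "open {\<xi>. norm (e - adjoint (symbol A \<xi>) y) < c}" for y
    by (intro open_Collect_less continuous_intros continuous_adjoint_symbol)
  ultimately show "{\<xi> \<in> space borel. norm (e - row_projection (symbol A \<xi>) e) < c} \<in> sets borel"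
    by (simp add: borel_open open_UN)
qed

text \<open>The complementary projection is symmetric and idempotent, hence its matrix entries are obtained from
  the norms of its values by polarization.\<close>

lemma borel_measurable_row_projection_symbol:
  fixes A :: "'n::finite \<Rightarrow> 'e::euclidean_space \<Rightarrow>\<^sub>L 'f::euclidean_space"
  shows "(\<lambda>\<xi>. row_projection (symbol A \<xi>) e) \<in> borel_measurable borel"
proof (subst borel_measurable_euclidean_space, intro ballI)
  fix d :: 'e
  have polar: "row_projection T e \<bullet> d
     = e \<bullet> d - (norm ((e + d) - row_projection T (e + d)) ^ 2
          - norm ((e - d) - row_projection T (e - d)) ^ 2) / 4" for T :: "'e \<Rightarrow>\<^sub>L 'f"
  proof -
    let ?k = "\<lambda>e. e - row_projection T e"
    have "norm (?k (e + d)) ^ 2 - norm (?k (e - d)) ^ 2 = 4 * (?k e \<bullet> ?k d)"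
      unfolding power2_norm_eq_inner blinfun.add_right blinfun.diff_right
      by (simp add: algebra_simps inner_simps inner_commute)
    also have "?k e \<bullet> ?k d = e \<bullet> d - row_projection T e \<bullet> d"
      by (simp add: inner_diff_left inner_diff_right row_projection_symmetric)
    finally have "norm (?k (e + d)) ^ 2 - norm (?k (e - d)) ^ 2
        = 4 * (e \<bullet> d - row_projection T e \<bullet> d)" .
    moreover have "b = a - c / 4" if "c = 4 * (a - b)" for a b c :: real
      using that by (simp add: field_simps)
    ultimately show ?thesis by blast
  qed
  show "(\<lambda>\<xi>. row_projection (symbol A \<xi>) e \<bullet> d) \<in> borel_measurable borel"
    unfolding polar
    by (intro borel_measurable_diff borel_measurable_const borel_measurable_divide
        borel_measurable_power borel_measurable_symbol_kernel_norm)
qed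

lemma borel_measurable_symbol_apply:
  fixes A :: "'n::finite \<Rightarrow> 'e::euclidean_space \<Rightarrow>\<^sub>L 'f::euclidean_space"
  assumes "f \<in> borel_measurable M" "g \<in> borel_measurable M"
  shows "(\<lambda>z. symbol A (f z) (g z)) \<in> borel_measurable M"
proof -
  have "(\<lambda>z. A j (g z)) \<in> borel_measurable M" for j
    by (rule measurable_compose[OF assms(2)])
      (intro borel_measurable_continuous_onI linear_continuous_on blinfun.bounded_linear_right)
  moreover have "(\<lambda>z. f z $ j) \<in> borel_measurable M" for j
    by (rule measurable_compose[OF assms(1)]) measurable
  ultimately show ?thesis
    unfolding symbol_apply by (intro borel_measurable_sum borel_measurable_scaleR)
qed

lemma norm_symbol_apply_le:
  assumes "norm \<xi> \<le> 1"
  shows "norm (symbol A \<xi> e) \<le> (\<Sum>j\<in>UNIV. norm (A j)) * norm e"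
proof -
  have "norm (symbol A \<xi> e) \<le> (\<Sum>j\<in>UNIV. norm ((\<xi> $ j) *\<^sub>R A j e))"
    unfolding symbol_apply by (rule norm_sum)
  also have "\<dots> \<le> (\<Sum>j\<in>UNIV. norm (A j) * norm e)"
  proof (rule sum_mono)
    fix j
    have "\<bar>\<xi> $ j\<bar> \<le> 1" using assms component_le_norm_cart[of \<xi> j] by simp
    then have "\<bar>\<xi> $ j\<bar> * norm (A j e) \<le> 1 * (norm (A j) * norm e)"
      by (intro mult_mono norm_blinfun) auto
    then show "norm ((\<xi> $ j) *\<^sub>R A j e) \<le> norm (A j) * norm e" by simp
  qed
  finally show ?thesis by (simp add: sum_distrib_right)
qed

lemma symbol_scaleR: "symbol A (c *\<^sub>R \<xi>) e = c *\<^sub>R symbol A \<xi> e"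
  by (simp add: symbol_apply scaleR_sum_right)

section \<open>Radial test functions\<close>

lemma sum_axis_mult: "(\<Sum>i\<in>UNIV. axis j (1::real) $ i * g i) = g j"
proof -
  have "(\<Sum>i\<in>UNIV. axis j (1::real) $ i * g i) = (\<Sum>i\<in>UNIV. if i = j then g i else 0)"
    by (rule sum.cong) (auto simp: axis_def)
  then show ?thesis by simp
qed

text \<open>The recursion for \<open>C_k (Suc k)\<close> does not mention continuity of the function itself; differentiability
  supplies it at the bottom of the induction.\<close>

lemma C_k_Suc_imp: "C_k (Suc k) f \<Longrightarrow> C_k k f"
proof (induction k arbitrary: f)
  case 0
  then have "\<forall>x. f differentiable at x" by simp
  then show ?case
    by (auto intro!: continuous_at_imp_continuous_on differentiable_imp_continuous_within)
next
  case (Suc k)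
  then have "\<forall>x. f differentiable at x" and "\<forall>j. C_k k (partial_deriv j f)"
    by auto
  then show ?case by simp
qed

text \<open>Partial derivatives are read off from a total derivative, which is how smoothness is established for
  all functions below.\<close>

lemma C_k_SucI:
  assumes "\<And>y. (f has_derivative (\<lambda>h. \<Sum>j\<in>UNIV. h $ j * D j y)) (at y)" "\<And>j. C_k k (D j)"
  shows "C_k (Suc k) f"
proof -
  have "partial_deriv j f = D j" for j
  proof
    fix y
    show "partial_deriv j f y = D j y"
      unfolding partial_deriv_def frechet_derivative_at[OF assms(1), symmetric]
      by (rule sum_axis_mult)
  qed
  then show ?thesis
    using assms unfolding C_k.simps differentiable_def by auto
qed

lemma C_k_derivative:
  assumes "C_k (Suc k) f"
  shows "(f has_derivative (\<lambda>h. \<Sum>j\<in>UNIV. h $ j * partial_deriv j f y)) (at y)"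
proof -
  have diff: "f differentiable at y" using assms by simp
  then have lin: "linear (frechet_derivative f (at y))"
    by (rule linear_frechet_derivative)
  have "frechet_derivative f (at y) h = (\<Sum>j\<in>UNIV. h $ j * partial_deriv j f y)" for h
  proof -
    have "frechet_derivative f (at y) h = frechet_derivative f (at y) (\<Sum>j\<in>UNIV. (h $ j) *\<^sub>R axis j 1)"
      by (metis basis_expansion scalar_mult_eq_scaleR)
    also have "\<dots> = (\<Sum>j\<in>UNIV. h $ j * partial_deriv j f y)"
      by (simp add: linear_sum[OF lin] linear_scale[OF lin] partial_deriv_def)
    finally show ?thesis .
  qed
  then have "frechet_derivative f (at y) = (\<lambda>h. \<Sum>j\<in>UNIV. h $ j * partial_deriv j f y)" by auto
  then show ?thesis using diff frechet_derivative_works by metis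
qed

lemma C_k_const: "C_k k (\<lambda>_. c)"
proof (induction k arbitrary: c)
  case (Suc k)
  show ?case by (rule C_k_SucI[where D = "\<lambda>_ _. 0"]) (auto simp: Suc)
qed simp

lemma C_k_component: "C_k k (\<lambda>y::real^'n. y $ i)"
proof (cases k)
  case (Suc k')
  have "(\<lambda>h::real^'n. h $ i) = (\<lambda>h. \<Sum>j\<in>UNIV. h $ j * (if j = i then 1 else 0))"
    by (auto simp: if_distrib cong: if_cong)
  moreover have "((\<lambda>y::real^'n. y $ i) has_derivative (\<lambda>h. h $ i)) (at y)" for y
    by (rule bounded_linear_imp_has_derivative) (rule bounded_linear_vec_nth)
  ultimately show ?thesis unfolding Suc
    by (intro C_k_SucI[where D = "\<lambda>j _. if j = i then 1 else 0"]) (auto intro: C_k_const)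
qed (auto intro: continuous_intros)

lemma C_k_add:
  assumes "C_k k f" "C_k k g"
  shows "C_k k (\<lambda>y. f y + g y)"
  using assms
proof (induction k arbitrary: f g)
  case (Suc k)
  have "((\<lambda>y. f y + g y) has_derivative
      (\<lambda>h. \<Sum>j\<in>UNIV. h $ j * (partial_deriv j f y + partial_deriv j g y))) (at y)" for y
    using has_derivative_add[OF C_k_derivative[OF Suc.prems(1)] C_k_derivative[OF Suc.prems(2)]]
    by (simp add: distrib_left sum.distrib)
  then show ?case
    by (rule C_k_SucI) (use Suc in auto)
qed (auto intro: continuous_intros)

lemma C_k_mult:
  assumes "C_k k f" "C_k k g"
  shows "C_k k (\<lambda>y. f y * g y)"
  using assms
proof (induction k arbitrary: f g)
  case (Suc k)
  have "((\<lambda>y. f y * g y) has_derivative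
      (\<lambda>h. \<Sum>j\<in>UNIV. h $ j * (f y * partial_deriv j g y + partial_deriv j f y * g y))) (at y)" for y
    using has_derivative_mult[OF C_k_derivative[OF Suc.prems(1)] C_k_derivative[OF Suc.prems(2)], of y]
    by (simp add: distrib_left sum.distrib sum_distrib_left sum_distrib_right algebra_simps)
  moreover have "C_k k (\<lambda>y. f y * partial_deriv j g y + partial_deriv j f y * g y)" for j
    by (intro C_k_add Suc.IH C_k_Suc_imp[OF Suc.prems(1)] C_k_Suc_imp[OF Suc.prems(2)])
      (use Suc.prems in auto)
  ultimately show ?case by (rule C_k_SucI)
qed (auto intro: continuous_intros)

lemma C_k_sum: "(\<And>i. i \<in> I \<Longrightarrow> C_k k (f i)) \<Longrightarrow> C_k k (\<lambda>y. \<Sum>i\<in>I. f i y)"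
  by (induction I rule: infinite_finite_induct) (auto intro: C_k_const C_k_add)

lemma C_k_norm_sq: "C_k k (\<lambda>y. norm (y - x) ^ 2)"
proof -
  have "norm (y - x) ^ 2 = (\<Sum>i\<in>UNIV. (y $ i + (- (x $ i))) * (y $ i + (- (x $ i))))" for y
    unfolding power2_norm_eq_inner inner_vec_def by simp
  then show ?thesis
    by (simp only:) (intro C_k_sum C_k_mult C_k_add C_k_const C_k_component)
qed

text \<open>For \<open>t > 0\<close> this is \<open>t\<^sup>-\<^sup>m exp (- 1 / t)\<close>. The derivative of each member of the family is a linear
  combination of two others, so all of them are smooth, and \<open>flat 0\<close> takes values in the unit interval.\<close>

definition flat :: "nat \<Rightarrow> real \<Rightarrow> real" where
  "flat m t = (if t > 0 then inverse t ^ m * exp (- inverse t) else 0)"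

lemma flat_tendsto_0: "(flat m \<longlongrightarrow> 0) (at 0)"
proof -
  have "((\<lambda>t. inverse t ^ m / exp (inverse t)) \<longlongrightarrow> (0::real)) (at_right 0)"
    by (rule filterlim_compose[OF tendsto_power_div_exp_0 filterlim_inverse_at_top_right])
  then have "(flat m \<longlongrightarrow> 0) (at_right 0)"
    by (rule Lim_transform_eventually)
      (auto simp: flat_def exp_minus field_simps eventually_at_right_less intro!: eventually_mono[OF eventually_at_right_less[of 0]])
  moreover have "(flat m \<longlongrightarrow> 0) (at_left 0)"
    by (rule Lim_transform_eventually[OF tendsto_const])
      (auto simp: flat_def eventually_at_filter)
  ultimately show ?thesis by (simp add: filterlim_split_at)
qed

lemma DERIV_flat: "(flat m has_real_derivative flat (m + 2) t - real m * flat (m + 1) t) (at t)"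
proof -
  consider "t < 0" | "t = 0" | "t > 0" by linarith
  then show ?thesis
  proof cases
    case 1
    have "((\<lambda>_. 0) has_real_derivative 0) (at t)" by simp
    moreover have "eventually (\<lambda>s. s \<in> {..<0}) (nhds t)"
      using 1 by (intro eventually_nhds_in_open) auto
    then have "\<forall>\<^sub>F s in nhds t. flat m s = 0"
      by eventually_elim (auto simp: flat_def)
    ultimately show ?thesis
      using 1 DERIV_cong_ev[of t t "flat m" "\<lambda>_. 0"] by (simp add: flat_def)
  next
    case 2
    have "(flat m s - flat m 0) / (s - 0) = flat (Suc m) s" for s
      by (auto simp: flat_def field_simps)
    then show ?thesis
      using flat_tendsto_0[of "Suc m"] 2 unfolding has_field_derivative_iff
      by (simp add: flat_def[of _ 0])
  next
    case 3
    have "((\<lambda>s. inverse s ^ m * exp (- inverse s)) has_real_derivative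
        flat (m + 2) t - real m * flat (m + 1) t) (at t)"
      using 3 by (auto intro!: derivative_eq_intros simp: flat_def field_simps power_Suc power2_eq_square)
        (cases m; simp add: field_simps)
    moreover have "eventually (\<lambda>s. s \<in> {0<..}) (nhds t)"
      using 3 by (intro eventually_nhds_in_open) auto
    then have "\<forall>\<^sub>F s in nhds t. flat m s = inverse s ^ m * exp (- inverse s)"
      by eventually_elim (auto simp: flat_def)
    ultimately show ?thesis
      by - (rule DERIV_cong_ev[OF refl _ refl, THEN iffD2])
  qed
qed

text \<open>The induction has to run over all \<open>m\<close> at once, since differentiating raises \<open>m\<close>.\<close>

lemma C_k_flat_compose:
  fixes q :: "real^'n \<Rightarrow> real"
  assumes "\<And>k. C_k k q"
  shows "C_k k (\<lambda>y. flat m (q y))"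
proof (induction k arbitrary: m)
  case 0
  have "continuous_on UNIV (flat m)"
    using DERIV_flat by (meson DERIV_isCont continuous_at_imp_continuous_on)
  then show ?case
    using assms[of 0] continuous_on_compose2[of UNIV "flat m" UNIV q] by auto
next
  case (Suc k)
  let ?d = "\<lambda>y. flat (m + 2) (q y) + (- real m) * flat (m + 1) (q y)"
  have "((\<lambda>y. flat m (q y)) has_derivative
      (\<lambda>h. \<Sum>j\<in>UNIV. h $ j * (?d y * partial_deriv j q y))) (at y)" for y
    using has_derivative_compose[OF C_k_derivative[OF assms, of y] DERIV_flat[of m "q y", unfolded has_field_derivative_def]]
    by (simp add: sum_distrib_left sum_distrib_right algebra_simps sum_subtractf)
  moreover have "C_k k (\<lambda>y. ?d y * partial_deriv j q y)" for j
    using assms[of "Suc k"] by (intro C_k_mult C_k_add C_k_const Suc) auto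
  ultimately show ?case by (rule C_k_SucI)
qed

text \<open>A smooth function that vanishes outside the interval from \<open>a\<close> to \<open>b\<close>. Since \<open>flat 0\<close> increases to \<open>1\<close> at
  infinity, the functions tend to the indicator of the open interval as \<open>k\<close> grows.\<close>

definition bump :: "real \<Rightarrow> real \<Rightarrow> nat \<Rightarrow> real \<Rightarrow> real" where
  "bump a b k s = flat 0 (real k * (s - a)) * flat 0 (real k * (b - s))"

lemma flat_0_bounds: "0 \<le> flat 0 t" "flat 0 t \<le> 1"
  by (auto simp: flat_def)

lemma bump_bounds: "0 \<le> bump a b k s" "bump a b k s \<le> 1"
  unfolding bump_def by (simp_all add: flat_0_bounds mult_le_one)

lemma bump_eq_0: "s \<le> a \<or> b \<le> s \<Longrightarrow> bump a b k s = 0"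
  unfolding bump_def flat_def by (auto simp: zero_less_mult_iff not_less)

lemma bump_tendsto_indicator: "(\<lambda>k. bump a b k s) \<longlonglongrightarrow> indicator {a<..<b} s"
proof (cases "a < s \<and> s < b")
  case True
  have flat: "(\<lambda>k. flat 0 (real k * d)) \<longlonglongrightarrow> 1" if "d > 0" for d
  proof -
    have "(\<lambda>k. exp (- (inverse (real k) * inverse d))) \<longlonglongrightarrow> exp (- (0 * inverse d))"
      by (intro tendsto_intros LIMSEQ_inverse_real_of_nat lim_inverse_n)
    moreover have "\<forall>\<^sub>F k in sequentially. exp (- (inverse (real k) * inverse d)) = flat 0 (real k * d)"
      using that by (intro eventually_mono[OF eventually_gt_at_top[of 0]]) (simp add: flat_def)
    ultimately show ?thesis by (simp add: Lim_transform_eventually)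
  qed
  have "(\<lambda>k. bump a b k s) \<longlonglongrightarrow> 1 * 1"
    unfolding bump_def by (intro tendsto_mult flat) (use True in auto)
  then show ?thesis using True by simp
next
  case False
  then show ?thesis using bump_eq_0[of s a b] by (auto simp: not_less)
qed

lemma continuous_bump: "continuous_on X (bump a b k)"
proof -
  have "continuous_on UNIV (flat 0)"
    using DERIV_flat by (meson DERIV_isCont continuous_at_imp_continuous_on)
  note flat = continuous_on_compose2[OF this]
  show ?thesis
    unfolding bump_def
    by (intro continuous_on_mult flat continuous_intros) auto
qed

lemma C_k_bump_norm_sq: "C_k m (\<lambda>y. bump a b k (norm (y - x) ^ 2))"
proof -
  have *: "real k * (t - a) = real k * t + (- (real k * a))"
    "real k * (b - t) = real k * b + (- real k) * t" for t
    by (simp_all add: algebra_simps)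
  show ?thesis
    unfolding bump_def *
    by (intro C_k_mult C_k_flat_compose C_k_add C_k_const C_k_norm_sq)
qed

lemma bump_primitive_eq_0:
  assumes der: "\<And>s. (\<theta> has_real_derivative bump a b k s) (at s)" and "\<theta> b = 0" and "b \<le> s"
  shows "\<theta> s = 0"
proof (cases "b = s")
  case False
  then have "b < s" using assms by simp
  obtain z where "b < z" "z < s" "\<theta> s - \<theta> b = (s - b) * bump a b k z"
    using MVT2[OF \<open>b < s\<close>, of \<theta> "bump a b k"] der by blast
  then show ?thesis using bump_eq_0[of z a b k] assms by simp
qed (use assms in simp)

text \<open>For a primitive \<open>\<theta>\<close> of a bump that vanishes from \<open>b\<close> on, \<open>\<theta>(|y - x|\<^sup>2)\<close> is a test function. It is the
  square of the distance that makes this smooth at the centre. The primitive \<open>\<theta>\<close> is differentiated only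
  once; all further derivatives are those of the bump.\<close>

lemma radial_test_function:
  fixes x :: "real^'n"
  assumes "cball x (sqrt b) \<subseteq> \<Omega>"
    and der: "\<And>s. (\<theta> has_real_derivative bump a b k s) (at s)" and "\<theta> b = 0"
  shows "test_function \<Omega> (\<lambda>y. \<theta> (norm (y - x) ^ 2))"
    and "partial_deriv j (\<lambda>y. \<theta> (norm (y - x) ^ 2)) y = 2 * (y - x) $ j * bump a b k (norm (y - x) ^ 2)"
proof -
  let ?\<phi> = "\<lambda>y. \<theta> (norm (y - x) ^ 2)"
  let ?D = "\<lambda>j y. (y $ j + - x $ j) * (2 * bump a b k (norm (y - x) ^ 2))"
  have D: "(?\<phi> has_derivative (\<lambda>h. \<Sum>j\<in>UNIV. h $ j * ?D j y)) (at y)" for y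
  proof -
    have "((\<lambda>y. norm (y - x) ^ 2) has_derivative (\<lambda>h. 2 * ((y - x) \<bullet> h))) (at y)"
      unfolding power2_norm_eq_inner
      by (auto intro!: derivative_eq_intros simp: inner_commute)
    then have "(?\<phi> has_derivative (\<lambda>h. bump a b k (norm (y - x) ^ 2) * (2 * ((y - x) \<bullet> h)))) (at y)"
      by (rule has_derivative_compose[OF _ der[unfolded has_field_derivative_def]])
    moreover have "bump a b k (norm (y - x) ^ 2) * (2 * ((y - x) \<bullet> h)) = (\<Sum>j\<in>UNIV. h $ j * ?D j y)" for h
      unfolding inner_vec_def sum_distrib_left by (rule sum.cong) auto
    ultimately show ?thesis by simp
  qed
  have CD: "C_k m (?D j)" for m j
    by (intro C_k_mult C_k_add C_k_component C_k_const C_k_bump_norm_sq)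
  have Suc: "C_k (Suc m) ?\<phi>" for m
    using D CD by (rule C_k_SucI)
  then have C: "C_k m ?\<phi>" for m by (rule C_k_Suc_imp)
  note zero = bump_primitive_eq_0[OF der \<open>\<theta> b = 0\<close>]
  have "{y. ?\<phi> y \<noteq> 0} \<subseteq> cball x (sqrt b)"
  proof
    fix y assume "y \<in> {y. ?\<phi> y \<noteq> 0}"
    then have "norm (y - x) ^ 2 < b" using zero[of "norm (y - x) ^ 2"] by (cases "norm (y - x) ^ 2 < b") auto
    then show "y \<in> cball x (sqrt b)"
      by (simp add: dist_norm norm_minus_commute real_le_rsqrt)
  qed
  then have cl: "closure {y. ?\<phi> y \<noteq> 0} \<subseteq> cball x (sqrt b)"
    by (simp add: closure_minimal)
  then have "compact (closure {y. ?\<phi> y \<noteq> 0})"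
    by (meson bounded_cball bounded_subset closed_closure compact_eq_bounded_closed)
  then show "test_function \<Omega> ?\<phi>"
    unfolding test_function_def using C cl assms(1) by auto
  show "partial_deriv j ?\<phi> y = 2 * (y - x) $ j * bump a b k (norm (y - x) ^ 2)"
    unfolding partial_deriv_def frechet_derivative_at[OF D, symmetric] sum_axis_mult by simp
qed

section \<open>Polar coordinates for the cone measure\<close>

text \<open>The cone measure before completion. It lives on the Borel sets of the sphere, so product measures and
  Fubini apply to it.\<close>

definition sphere_measure :: "(real^'n) measure" where
  "sphere_measure = scale_measure (of_nat CARD('n))
     (distr (restrict_space lborel (cball 0 1 - {0})) (restrict_space borel (sphere 0 1)) sgn)"

lemma surface_measure_completion: "surface_measure = completion sphere_measure"
  unfolding surface_measure_def sphere_measure_def ..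

lemma space_sphere_measure [simp]: "space sphere_measure = sphere 0 1"
  unfolding sphere_measure_def by (simp add: space_scale_measure space_restrict_space)

lemma sets_sphere_measure [measurable_cong]: "sets sphere_measure = sets (restrict_space borel (sphere 0 1))"
  unfolding sphere_measure_def by simp

lemma borel_measurable_sgn: "(sgn :: real^'n \<Rightarrow> _) \<in> borel_measurable borel"
  unfolding sgn_div_norm by measurable

lemma measurable_sgn_sphere:
  assumes "X \<in> sets borel" "0 \<notin> X"
  shows "(sgn :: real^'n \<Rightarrow> _) \<in> restrict_space lborel X \<rightarrow>\<^sub>M restrict_space borel (sphere 0 1)"
proof (rule measurable_restrict_space2)
  show "sgn \<in> space (restrict_space lborel X) \<rightarrow> sphere 0 1"
    using assms by (auto simp: space_restrict_space norm_sgn)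
  show "(sgn :: real^'n \<Rightarrow> _) \<in> borel_measurable (restrict_space lborel X)"
    using borel_measurable_sgn by (simp add: measurable_restrict_space1)
qed

lemma borel_measurable_sphere_measure:
  "f \<in> borel_measurable borel \<Longrightarrow> f \<in> borel_measurable sphere_measure"
  unfolding measurable_cong_sets[OF sets_sphere_measure refl] by (rule measurable_restrict_space1)

lemma borel_measurable_surface_measure:
  "f \<in> borel_measurable borel \<Longrightarrow> f \<in> borel_measurable surface_measure"
  unfolding surface_measure_completion
  by (intro measurable_completion borel_measurable_sphere_measure)

abbreviation punctured_ball :: "real \<Rightarrow> (real^'n) set" where
  "punctured_ball R \<equiv> cball 0 R - {0}"

lemma cone_sets:
  assumes "B \<in> sets (restrict_space borel (sphere 0 (1::real)) :: (real^'n) measure)"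
  shows "{y \<in> punctured_ball R. sgn y \<in> B} \<in> sets borel"
proof -
  have "B \<in> sets borel"
    using assms by (auto simp: sets_restrict_space)
  then have "sgn -` B \<inter> space borel \<in> sets borel"
    using borel_measurable_sgn by (rule measurable_sets[rotated])
  then have "punctured_ball R \<inter> (sgn -` B \<inter> space borel) \<in> sets borel"
    by (intro sets.Int) auto
  then show ?thesis by (simp add: vimage_def Int_def)
qed

lemma emeasure_restrict_punctured_ball:
  "emeasure (restrict_space lborel (punctured_ball R)) {y \<in> punctured_ball R. P y}
    = emeasure lborel {y \<in> punctured_ball R. P y}"
  by (rule emeasure_restrict_space) auto

lemma emeasure_sphere_measure:
  assumes "B \<in> sets (restrict_space borel (sphere 0 (1::real)) :: (real^'n) measure)"
  shows "emeasure sphere_measure B = of_nat CARD('n) * emeasure lborel {y \<in> punctured_ball 1. sgn y \<in> B}"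
proof -
  have "sgn -` B \<inter> space (restrict_space lborel (punctured_ball 1)) = {y \<in> punctured_ball 1. sgn y \<in> B}"
    by (auto simp: space_restrict_space)
  then show ?thesis
    unfolding sphere_measure_def using assms emeasure_restrict_punctured_ball[of 1 "\<lambda>y. sgn y \<in> B"]
    by (simp add: emeasure_distr measurable_sgn_sphere)
qed

lemma cone_finite:
  fixes P :: "real^'n \<Rightarrow> bool"
  shows "emeasure lborel {y \<in> punctured_ball R. P y} < \<infinity>"
proof -
  have "emeasure lborel {y \<in> punctured_ball R. P y} \<le> emeasure lborel (cball (0::real^'n) R)"
    by (rule emeasure_mono) auto
  then show ?thesis
    by (rule order.strict_trans1) (rule emeasure_lborel_cball_finite)
qed

lemma finite_measure_sphere_measure: "finite_measure (sphere_measure :: (real^'n) measure)"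
proof
  have "emeasure sphere_measure (sphere 0 1 :: (real^'n) set) < \<infinity>"
    using cone_finite[of 1 "\<lambda>y::real^'n. sgn y \<in> sphere 0 1"] by (subst emeasure_sphere_measure)
      (auto simp: sets_restrict_space ennreal_mult_less_top image_iff of_nat_less_top intro!: bexI[of _ UNIV])
  then show "emeasure sphere_measure (space (sphere_measure :: (real^'n) measure)) \<noteq> \<infinity>" by simp
qed

text \<open>Truncated cones are dilates of each other, so their volume is homogeneous of degree \<open>n\<close>. This is the
  reason why the cone measure is the angular part of Lebesgue measure.\<close>

lemma cone_scale:
  assumes "0 < a" "B \<in> sets (restrict_space borel (sphere 0 (1::real)) :: (real^'n) measure)"
  shows "emeasure lborel {y \<in> punctured_ball a. sgn y \<in> B}
    = ennreal (a ^ CARD('n)) * emeasure lborel {y \<in> punctured_ball 1. sgn y \<in> B}" (is "emeasure _ (?E a) = _")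
proof -
  have pre: "(\<lambda>y. 0 + a *\<^sub>R y) -` ?E a \<inter> space lborel = ?E 1"
    using assms(1) by (auto simp: sgn_scaleR)
  have "emeasure lborel (?E a)
      = emeasure (density (distr lborel borel (\<lambda>y. 0 + a *\<^sub>R y)) (\<lambda>_. ennreal (\<bar>a\<bar> ^ DIM(real^'n)))) (?E a)"
    using lborel_affine[of a "0::real^'n"] assms(1) by simp
  also have "\<dots> = ennreal (a ^ CARD('n)) * emeasure (distr lborel borel (\<lambda>y. 0 + a *\<^sub>R y)) (?E a)"
    using assms cone_sets[OF assms(2), of a]
    by (subst emeasure_density) (auto simp: nn_integral_cmult)
  also have "emeasure (distr lborel borel (\<lambda>y. 0 + a *\<^sub>R y)) (?E a) = emeasure lborel (?E 1)"
    using cone_sets[OF assms(2), of a] pre by (subst emeasure_distr) auto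
  finally show ?thesis .
qed

text \<open>The radial part \<open>r\<^sup>n\<^sup>-\<^sup>1 dr\<close> on the radii of the punctured ball of radius \<open>R\<close>.\<close>

definition radial_measure :: "nat \<Rightarrow> real \<Rightarrow> real measure" where
  "radial_measure n R = density lborel (\<lambda>r. ennreal (r ^ (n - 1)) * indicator {0<..R} r)"

lemma sets_radial_measure [simp, measurable_cong]: "sets (radial_measure n R) = sets borel"
  and space_radial_measure [simp]: "space (radial_measure n R) = UNIV"
  unfolding radial_measure_def by simp_all

lemma emeasure_radial_measure:
  assumes "n > 0" "0 \<le> a" "a \<le> R"
  shows "emeasure (radial_measure n R) {a<..} = ennreal ((R ^ n - a ^ n) / n)"
proof -
  have "emeasure (radial_measure n R) {a<..}
      = (\<integral>\<^sup>+r. ennreal (r ^ (n - 1)) * indicator {0<..R} r * indicator {a<..} r \<partial>lborel)"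
    unfolding radial_measure_def by (rule emeasure_density) auto
  also have "\<dots> = (\<integral>\<^sup>+r. ennreal (r ^ (n - 1)) * indicator {a..R} r \<partial>lborel)"
    by (rule nn_integral_cong_AE, rule AE_mp[OF AE_lborel_singleton[of a]])
      (use assms in \<open>auto simp: indicator_def intro!: AE_I2\<close>)
  also have "\<dots> = ennreal (R ^ n / n - a ^ n / n)"
    by (rule nn_integral_FTC_Icc)
      (use assms in \<open>auto intro!: derivative_eq_intros simp: field_simps\<close>)
  finally show ?thesis by (simp add: diff_divide_distrib)
qed

lemma finite_measure_radial_measure:
  assumes "n > 0" "0 \<le> R" shows "finite_measure (radial_measure n R)"
proof
  have "emeasure (radial_measure n R) UNIV = emeasure (radial_measure n R) {0<..}"
    unfolding radial_measure_def
    by (simp add: emeasure_density) (auto intro!: nn_integral_cong simp: indicator_def)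
  then show "emeasure (radial_measure n R) (space (radial_measure n R)) \<noteq> \<infinity>"
    using emeasure_radial_measure[of n 0 R] assms by simp
qed

text \<open>For a fixed set \<open>B\<close> of directions both sides are finite Borel measures in the set \<open>A\<close> of radii. They
  agree on rays because a shell of a cone is a difference of two dilates of the same cone.\<close>

lemma cone_radial_slice:
  assumes "0 < R" "A \<in> sets borel" "B \<in> sets (restrict_space borel (sphere 0 (1::real)) :: (real^'n) measure)"
  shows "emeasure (radial_measure CARD('n) R) A * emeasure sphere_measure B
    = emeasure lborel {y \<in> punctured_ball R. norm y \<in> A \<and> sgn y \<in> B}"
proof -
  let ?n = "CARD('n)"
  define E where "E a = {y \<in> punctured_ball a. sgn y \<in> B}" for a
  have E [measurable]: "E a \<in> sets borel" for a
    unfolding E_def using assms(3) by (rule cone_sets)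
  have fin: "emeasure lborel (E a) < \<infinity>" for a
    unfolding E_def by (rule cone_finite)
  obtain c where c: "c \<ge> 0" "emeasure lborel (E 1) = ennreal c"
    using fin[of 1] by (cases "emeasure lborel (E 1)") auto
  have scale: "emeasure lborel (E a) = ennreal (a ^ ?n * c)" if "0 \<le> a" for a
  proof (cases "a = 0")
    case True
    then have "E a = {}" by (auto simp: E_def)
    then show ?thesis using True by (simp add: zero_power)
  next
    case False
    then show ?thesis
      using cone_scale[of a B] assms(3) that c unfolding E_def by (simp add: ennreal_mult)
  qed
  have sB: "emeasure sphere_measure B = ennreal (?n * c)"
    using emeasure_sphere_measure[OF assms(3)] c
    unfolding E_def[symmetric] by (simp add: ennreal_mult ennreal_of_nat_eq_real_of_nat)
  let ?M = "scale_measure (emeasure sphere_measure B) (radial_measure ?n R)"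
  let ?N = "distr (restrict_space lborel (E R)) borel norm"
  have norm: "norm \<in> restrict_space lborel (E R) \<rightarrow>\<^sub>M borel"
    by (intro measurable_restrict_space1) simp
  have N: "emeasure ?N A = emeasure lborel {y \<in> punctured_ball R. norm y \<in> A \<and> sgn y \<in> B}"
    if "A \<in> sets borel" for A
  proof -
    have "emeasure ?N A = emeasure lborel (norm -` A \<inter> E R)"
      using that norm emeasure_restrict_space[of "E R" lborel "norm -` A \<inter> E R"] E[of R]
      by (simp add: emeasure_distr space_restrict_space)
    also have "norm -` A \<inter> E R = {y \<in> punctured_ball R. norm y \<in> A \<and> sgn y \<in> B}"
      by (auto simp: E_def)
    finally show ?thesis .
  qed
  have main: "emeasure ?M {s<..} = ennreal ((R ^ ?n - a ^ ?n) * c)"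
      "emeasure ?N {s<..} = ennreal ((R ^ ?n - a ^ ?n) * c)" if a_def: "a = min R (max 0 s)" for a s
  proof -
    have a: "0 \<le> a" "a \<le> R" using assms(1) by (auto simp: a_def)
    have pow: "a ^ ?n \<le> R ^ ?n" using a by (intro power_mono) auto
    have iff: "s < r \<longleftrightarrow> a < r" if "0 < r" "r \<le> R" for r
      using that by (auto simp: a_def)
    have "emeasure (radial_measure ?n R) {s<..} = emeasure (radial_measure ?n R) {a<..}"
      unfolding radial_measure_def using iff
      by (simp add: emeasure_density) (auto intro!: nn_integral_cong simp: indicator_def)
    then show "emeasure ?M {s<..} = ennreal ((R ^ ?n - a ^ ?n) * c)"
      using a pow c(1) by (simp add: sB emeasure_radial_measure ennreal_mult[symmetric])
    have "{y \<in> punctured_ball R. norm y \<in> {s<..} \<and> sgn y \<in> B} = E R - E a"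
      using iff a by (auto simp: E_def)
    then have "emeasure ?N {s<..} = emeasure lborel (E R - E a)"
      by (simp add: N)
    also have "\<dots> = emeasure lborel (E R) - emeasure lborel (E a)"
    proof (rule emeasure_Diff)
      show "E a \<subseteq> E R" using a by (auto simp: E_def)
    qed (use fin[of a] E in auto)
    also have "\<dots> = ennreal ((R ^ ?n - a ^ ?n) * c)"
      using a assms(1) c(1) pow by (simp add: scale ennreal_minus left_diff_distrib)
    finally show "emeasure ?N {s<..} = ennreal ((R ^ ?n - a ^ ?n) * c)" .
  qed
  have "?M = ?N"
  proof (rule measure_eqI_lessThan)
    show "emeasure ?M {s<..} < \<infinity>" for s using main(1)[OF refl] by simp
    show "emeasure ?M {s<..} = emeasure ?N {s<..}" for s using main[OF refl] by simp
  qed simp_all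
  then have "emeasure ?M A = emeasure ?N A" by simp
  then show ?thesis using N[OF assms(2)] by (simp add: mult.commute)
qed

text \<open>Both measures agree on rectangles by the preceding lemma, and rectangles determine a product measure.\<close>

lemma polar_coordinates:
  assumes "0 < R"
  shows "radial_measure CARD('n) R \<Otimes>\<^sub>M (sphere_measure :: (real^'n) measure)
    = distr (restrict_space lborel (punctured_ball R))
        (borel \<Otimes>\<^sub>M restrict_space borel (sphere 0 1)) (\<lambda>y. (norm y, sgn y))"
proof (rule pair_measure_eqI)
  interpret S: finite_measure "sphere_measure :: (real^'n) measure" by (rule finite_measure_sphere_measure)
  interpret r: finite_measure "radial_measure CARD('n) R"
    using assms by (intro finite_measure_radial_measure) auto
  show "sigma_finite_measure (radial_measure CARD('n) R)" "sigma_finite_measure (sphere_measure :: (real^'n) measure)"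
    by unfold_locales
  show "sets (radial_measure CARD('n) R \<Otimes>\<^sub>M (sphere_measure :: (real^'n) measure))
      = sets (distr (restrict_space lborel (punctured_ball R)) (borel \<Otimes>\<^sub>M restrict_space borel (sphere 0 1))
          (\<lambda>y. (norm y, sgn y)))"
    by (simp add: sets_sphere_measure cong: sets_pair_measure_cong)
  fix A :: "real set" and B :: "(real^'n) set"
  assume A: "A \<in> sets (radial_measure CARD('n) R)" and B: "B \<in> sets sphere_measure"
  have meas: "(\<lambda>y. (norm y, sgn y)) \<in> restrict_space lborel (punctured_ball R)
      \<rightarrow>\<^sub>M borel \<Otimes>\<^sub>M (restrict_space borel (sphere 0 1) :: (real^'n) measure)"
    by (intro measurable_Pair measurable_sgn_sphere measurable_restrict_space1) auto
  have "(\<lambda>y. (norm y, sgn y)) -` (A \<times> B) \<inter> space (restrict_space lborel (punctured_ball R))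
      = {y \<in> punctured_ball R. norm y \<in> A \<and> sgn y \<in> B}"
    by (auto simp: space_restrict_space)
  moreover have "A \<times> B \<in> sets (borel \<Otimes>\<^sub>M (restrict_space borel (sphere 0 1) :: (real^'n) measure))"
    using A B by (simp add: sets_sphere_measure)
  ultimately show "emeasure (radial_measure CARD('n) R) A * emeasure sphere_measure B
      = emeasure (distr (restrict_space lborel (punctured_ball R))
          (borel \<Otimes>\<^sub>M restrict_space borel (sphere 0 1)) (\<lambda>y. (norm y, sgn y))) (A \<times> B)"
    using meas A B cone_radial_slice[OF assms, of A B]
      emeasure_restrict_punctured_ball[of R "\<lambda>y. norm y \<in> A \<and> sgn y \<in> B"]
    by (subst emeasure_distr) (auto simp: sets_sphere_measure)
qed

lemma measurable_polar:
  "(\<lambda>y. (norm y, sgn y)) \<in> restrict_space lborel (punctured_ball R)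
      \<rightarrow>\<^sub>M borel \<Otimes>\<^sub>M (restrict_space borel (sphere 0 1) :: (real^'n) measure)"
  by (intro measurable_Pair measurable_sgn_sphere measurable_restrict_space1) auto

lemma measurable_unpolar:
  "(\<lambda>(r, \<xi>). r *\<^sub>R \<xi>) \<in> borel_measurable (borel \<Otimes>\<^sub>M (restrict_space borel (sphere 0 1) :: (real^'n) measure))"
proof -
  have "(\<lambda>\<xi>. \<xi>) \<in> borel_measurable (restrict_space borel (sphere 0 1) :: (real^'n) measure)"
    by (rule measurable_restrict_space1) simp
  then have [measurable]: "snd \<in> borel_measurable (borel \<Otimes>\<^sub>M (restrict_space borel (sphere 0 1) :: (real^'n) measure))"
    using measurable_compose[OF measurable_snd] by fastforce
  show ?thesis
    unfolding split_beta by measurable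
qed

lemma pair_sigma_finite_polar:
  "0 < R \<Longrightarrow> pair_sigma_finite (radial_measure CARD('n) R) (sphere_measure :: (real^'n) measure)"
  unfolding pair_sigma_finite_def
  using finite_measure_sphere_measure finite_measure_radial_measure[of "CARD('n)" R]
    finite_measure.axioms(1) zero_less_card_finite by (metis less_imp_le)

lemma AE_radial_measure:
  "(AE r in radial_measure n R. P r) \<longleftrightarrow> (AE r in lborel. 0 < r \<and> r \<le> R \<longrightarrow> P r)"
  unfolding radial_measure_def
  by (subst AE_density) (auto simp: indicator_def intro!: AE_cong)

lemma norm_scaleR_sgn_self [simp]: "norm y *\<^sub>R sgn y = (y :: real^'n)"
  by (cases "y = 0") (simp_all add: sgn_div_norm)

lemma polar_integral:
  fixes f :: "real^'n \<Rightarrow> 'b::{banach, second_countable_topology}"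
  assumes "0 < R" and f: "f \<in> borel_measurable borel"
    and int: "integrable (restrict_space lborel (punctured_ball R)) f"
  shows "AE r in lborel. 0 < r \<and> r \<le> R \<longrightarrow> integrable sphere_measure (\<lambda>\<xi>. f (r *\<^sub>R \<xi>))"
    and "integrable (radial_measure CARD('n) R) (\<lambda>r. LINT \<xi>|sphere_measure. f (r *\<^sub>R \<xi>))"
    and "(LINT y|restrict_space lborel (punctured_ball R). f y)
      = (LINT r|radial_measure CARD('n) R. LINT \<xi>|sphere_measure. f (r *\<^sub>R \<xi>))"
proof -
  interpret pair_sigma_finite "radial_measure CARD('n) R" "sphere_measure :: (real^'n) measure"
    using assms(1) by (rule pair_sigma_finite_polar)
  let ?P = "radial_measure CARD('n) R \<Otimes>\<^sub>M (sphere_measure :: (real^'n) measure)"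
  let ?F = "\<lambda>(r, \<xi>). f (r *\<^sub>R \<xi>)"
  have F: "?F \<in> borel_measurable (borel \<Otimes>\<^sub>M (restrict_space borel (sphere 0 1) :: (real^'n) measure))"
    using measurable_compose[OF measurable_unpolar f] by (simp add: split_beta)
  have "integrable ?P ?F"
    unfolding polar_coordinates[OF assms(1)]
    using int by (subst integrable_distr_eq[OF measurable_polar F]) simp
  then show "AE r in lborel. 0 < r \<and> r \<le> R \<longrightarrow> integrable sphere_measure (\<lambda>\<xi>. f (r *\<^sub>R \<xi>))"
    and "integrable (radial_measure CARD('n) R) (\<lambda>r. LINT \<xi>|sphere_measure. f (r *\<^sub>R \<xi>))"
    using AE_integrable_fst[of "\<lambda>r \<xi>. f (r *\<^sub>R \<xi>)"] integrable_fst[of "\<lambda>r \<xi>. f (r *\<^sub>R \<xi>)"]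
    by (simp_all add: AE_radial_measure)
  have *: "(LINT r|radial_measure CARD('n) R. LINT \<xi>|sphere_measure. f (r *\<^sub>R \<xi>)) = (LINT z|?P. ?F z)"
    using integral_fst[of "\<lambda>r \<xi>. f (r *\<^sub>R \<xi>)"] \<open>integrable ?P ?F\<close> by simp
  show "(LINT y|restrict_space lborel (punctured_ball R). f y)
      = (LINT r|radial_measure CARD('n) R. LINT \<xi>|sphere_measure. f (r *\<^sub>R \<xi>))"
    unfolding * polar_coordinates[OF assms(1)]
    by (subst integral_distr[OF measurable_polar F]) simp
qed

text \<open>A Lebesgue null set meets almost every sphere in a null set. This is what allows a representative to
  be changed without affecting almost every spherical integral.\<close>

lemma AE_polar:
  fixes P :: "real^'n \<Rightarrow> bool"
  assumes "0 < R" and ae: "AE y in lborel. P y"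
  shows "AE r in lborel. 0 < r \<and> r \<le> R \<longrightarrow> (AE \<xi> in sphere_measure. P (r *\<^sub>R \<xi>))"
proof -
  interpret pair_sigma_finite "radial_measure CARD('n) R" "sphere_measure :: (real^'n) measure"
    using assms(1) by (rule pair_sigma_finite_polar)
  obtain N where N: "N \<in> sets borel" "emeasure lborel N = 0" "{y. \<not> P y} \<subseteq> N"
    using ae by (auto simp: eventually_ae_filter null_sets_def)
  let ?B = "borel \<Otimes>\<^sub>M (restrict_space borel (sphere 0 1) :: (real^'n) measure)"
  have meas: "{z \<in> space ?B. (case z of (r, \<xi>) \<Rightarrow> r *\<^sub>R \<xi> \<notin> N)} \<in> sets ?B"
  proof -
    have "(\<lambda>(r, \<xi>). r *\<^sub>R \<xi>) -` (- N) \<inter> space ?B \<in> sets ?B"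
      using N(1) by (intro measurable_sets[OF measurable_unpolar]) auto
    then show ?thesis by (simp add: vimage_def split_beta Int_def conj_commute)
  qed
  have "AE y in restrict_space lborel (punctured_ball R). y \<notin> N"
    using N by (subst AE_restrict_space_iff) (auto intro: AE_mp[OF AE_not_in[of N]] simp: null_sets_def)
  then have "AE y in restrict_space lborel (punctured_ball R). norm y *\<^sub>R sgn y \<notin> N"
    by simp
  then have "AE z in distr (restrict_space lborel (punctured_ball R)) ?B (\<lambda>y. (norm y, sgn y)).
      (case z of (r, \<xi>) \<Rightarrow> r *\<^sub>R \<xi> \<notin> N)"
    using AE_distr_iff[OF measurable_polar meas] by simp
  then have "AE z in radial_measure CARD('n) R \<Otimes>\<^sub>M sphere_measure. (case z of (r, \<xi>) \<Rightarrow> r *\<^sub>R \<xi> \<notin> N)"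
    unfolding polar_coordinates[OF assms(1)] .
  from AE_pair[OF this]
  have "AE r in lborel. 0 < r \<and> r \<le> R \<longrightarrow> (AE \<xi> in sphere_measure. r *\<^sub>R \<xi> \<notin> N)"
    by (simp add: AE_radial_measure)
  then show ?thesis
    by (rule eventually_mono) (use N(3) in \<open>auto elim!: eventually_mono\<close>)
qed

section \<open>Second moments of the sphere\<close>

lemma integral_sphere_measure:
  fixes f :: "real^'n \<Rightarrow> 'b::{banach, second_countable_topology}"
  assumes f: "f \<in> borel_measurable borel"
  shows "(LINT \<xi>|sphere_measure. f \<xi>)
    = real CARD('n) *\<^sub>R (LINT y|lborel. indicator (punctured_ball 1) y *\<^sub>R f (sgn y))"
proof -
  let ?D = "distr (restrict_space lborel (cball 0 1 - {0})) (restrict_space borel (sphere 0 1)) sgn :: (real^'n) measure"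
  have fr: "f \<in> borel_measurable (restrict_space borel (sphere 0 1))"
    using f by (rule measurable_restrict_space1)
  have "(sphere_measure :: (real^'n) measure) = density ?D (\<lambda>_. ennreal (real CARD('n)))"
    by (rule measure_eqI)
      (auto simp: sphere_measure_def emeasure_density nn_integral_cmult_indicator ennreal_of_nat_eq_real_of_nat)
  then have "(LINT \<xi>|sphere_measure. f \<xi>) = real CARD('n) *\<^sub>R (LINT \<xi>|?D. f \<xi>)"
    using integral_density[of f ?D "\<lambda>_. real CARD('n)"] fr by simp
  also have "(LINT \<xi>|?D. f \<xi>) = (LINT y|restrict_space lborel (punctured_ball 1). f (sgn y))"
    by (rule integral_distr[OF measurable_sgn_sphere fr]) auto
  also have "\<dots> = (LINT y|lborel. indicator (punctured_ball 1) y *\<^sub>R f (sgn y))"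
    by (rule integral_restrict_space) simp
  finally show ?thesis .
qed

lemma lborel_distr_basis_permutation:
  fixes Q :: "'a::euclidean_space \<Rightarrow> 'a"
  assumes Q: "orthogonal_transformation Q" and invol: "\<And>y. Q (Q y) = y" and basis: "Q ` Basis = Basis"
  shows "distr lborel borel Q = lborel"
proof (rule lborel_eqI[symmetric])
  fix l u :: 'a assume lu: "\<And>b. b \<in> Basis \<Longrightarrow> l \<bullet> b \<le> u \<bullet> b"
  have lin: "linear Q" using Q by (rule orthogonal_transformation_linear)
  have adj: "Q a \<bullet> b = a \<bullet> Q b" for a b
    using Q invol unfolding orthogonal_transformation_def by metis
  have QB: "Q b \<in> Basis" if "b \<in> Basis" for b using basis that by auto
  have meas: "Q \<in> borel_measurable lborel"
    using lin borel_measurable_continuous_onI linear_continuous_on linear_conv_bounded_linear by auto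
  have "Q -` box l u = box (Q l) (Q u)"
    unfolding box_def using QB invol by (auto simp: adj) metis+
  then have "emeasure (distr lborel borel Q) (box l u) = emeasure lborel (box (Q l) (Q u))"
    using meas by (simp add: emeasure_distr)
  also have "\<dots> = (\<Prod>b\<in>Basis. (Q u - Q l) \<bullet> b)"
    using lu QB by (simp add: emeasure_lborel_box_eq adj inner_diff_left)
  also have "(\<Prod>b\<in>Basis. (Q u - Q l) \<bullet> b) = (\<Prod>b\<in>Basis. (u - l) \<bullet> Q b)"
    by (simp add: inner_diff_left adj)
  also have "\<dots> = (\<Prod>b\<in>Basis. (u - l) \<bullet> b)"
    by (rule prod.reindex_bij_betw)
      (use basis invol in \<open>auto simp: bij_betw_def intro: inj_on_inverseI\<close>)
  finally show "emeasure (distr lborel borel Q) (box l u) = (\<Prod>b\<in>Basis. (u - l) \<bullet> b)" .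
qed simp

lemma lborel_distr_reflection:
  assumes "c \<in> Basis"
  shows "distr lborel borel (\<lambda>y::'a::euclidean_space. y - (2 * (y \<bullet> c)) *\<^sub>R c) = lborel"
proof -
  let ?s = "\<lambda>b::'a. if b = c then - 1 else 1 :: real"
  have "0 + (\<Sum>b\<in>Basis. (?s b * (y \<bullet> b)) *\<^sub>R b) = y - (2 * (y \<bullet> c)) *\<^sub>R c" for y
  proof -
    have "(\<Sum>b\<in>Basis. (?s b * (y \<bullet> b)) *\<^sub>R b)
        = (\<Sum>b\<in>Basis. (y \<bullet> b) *\<^sub>R b - (if b = c then (2 * (y \<bullet> c)) *\<^sub>R c else 0))"
      by (rule sum.cong) (auto simp: scaleR_2 simp flip: scaleR_scaleR)
    also have "\<dots> = y - (2 * (y \<bullet> c)) *\<^sub>R c"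
      using assms by (simp add: sum_subtractf euclidean_representation)
    finally show ?thesis by simp
  qed
  moreover have "(\<Prod>b\<in>Basis. \<bar>?s b\<bar>) = 1"
    by (rule prod.neutral) auto
  moreover have "lborel = density (distr lborel borel (\<lambda>y. 0 + (\<Sum>b\<in>Basis. (?s b * (y \<bullet> b)) *\<^sub>R b)))
      (\<lambda>_. ennreal (\<Prod>b\<in>Basis. \<bar>?s b\<bar>))"
    by (rule lborel_affine_euclidean) auto
  ultimately show ?thesis by (simp only: density_1 ennreal_1)
qed

text \<open>An isometry commutes with \<open>sgn\<close> and preserves the punctured ball, so invariance of Lebesgue measure
  passes to the sphere. It is applied to coordinate reflections and to transpositions of coordinates.\<close>

lemma integral_sphere_measure_orthogonal:
  fixes f :: "real^'n \<Rightarrow> 'b::{banach, second_countable_topology}" and Q :: "real^'n \<Rightarrow> real^'n"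
  assumes Q: "orthogonal_transformation Q" and inv: "distr lborel borel Q = lborel"
    and f: "f \<in> borel_measurable borel"
  shows "(LINT \<xi>|sphere_measure. f (Q \<xi>)) = (LINT \<xi>|sphere_measure. f \<xi>)"
proof -
  have lin: "linear Q" using Q by (rule orthogonal_transformation_linear)
  then have meas: "Q \<in> borel_measurable borel"
    using borel_measurable_continuous_onI linear_continuous_on linear_conv_bounded_linear by blast
  have Qnorm: "norm (Q y) = norm y" for y using Q by (rule orthogonal_transformation_norm)
  have Qsgn: "Q (sgn y) = sgn (Q y)" for y
    by (simp add: sgn_div_norm linear_scale[OF lin] Qnorm)
  have "Q y = 0 \<longleftrightarrow> y = 0" for y using Qnorm[of y] norm_eq_zero by metis
  then have Qball: "indicator (punctured_ball 1) (Q y) = (indicator (punctured_ball 1) y :: real)" for y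
    by (simp add: indicator_def Qnorm)
  have g: "(\<lambda>y. indicator (punctured_ball 1) y *\<^sub>R f (sgn y)) \<in> borel_measurable borel"
    using measurable_compose[OF borel_measurable_sgn f]
    by (intro borel_measurable_scaleR borel_measurable_indicator) auto
  have "(LINT y|lborel. indicator (punctured_ball 1) y *\<^sub>R f (Q (sgn y)))
      = (LINT y|distr lborel borel Q. indicator (punctured_ball 1) y *\<^sub>R f (sgn y))"
    using meas g by (subst integral_distr) (auto simp: Qsgn Qball)
  then show ?thesis
    unfolding inv
    using f measurable_compose[OF meas f] by (simp add: integral_sphere_measure)
qed

lemma integrable_sphere_measure_bounded:
  fixes f :: "real^'n \<Rightarrow> 'b::{banach, second_countable_topology}"
  assumes "f \<in> borel_measurable borel" "\<And>\<xi>. norm \<xi> = 1 \<Longrightarrow> norm (f \<xi>) \<le> K"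
  shows "integrable sphere_measure f"
  by (rule finite_measure.integrable_const_bound[OF finite_measure_sphere_measure, of _ K])
    (use assms borel_measurable_sphere_measure in \<open>auto intro!: AE_I2\<close>)

text \<open>Reflecting the coordinate \<open>j\<close> shows that mixed moments vanish, transposing coordinates that the pure
  ones agree, and their sum is the total mass \<open>n \<omega>\<close> of the sphere.\<close>

lemma sphere_second_moments:
  fixes j k :: "'n::finite"
  shows "(LINT \<xi>|sphere_measure. \<xi> $ j * \<xi> $ k)
    = (if j = k then measure lebesgue (ball (0::real^'n) 1) else 0)"
proof -
  define m where "m j k = (LINT \<xi>|sphere_measure. \<xi> $ j * (\<xi>::real^'n) $ k)" for j k :: 'n
  have meas: "(\<lambda>\<xi>::real^'n. \<xi> $ j * \<xi> $ k) \<in> borel_measurable borel" for j k by measurable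
  have int: "integrable sphere_measure (\<lambda>\<xi>::real^'n. \<xi> $ j * \<xi> $ k)" for j k
  proof (rule integrable_sphere_measure_bounded[where K = 1, OF meas])
    fix \<xi> :: "real^'n" assume "norm \<xi> = 1"
    then show "norm (\<xi> $ j * \<xi> $ k) \<le> 1"
      using component_le_norm_cart[of \<xi> j] component_le_norm_cart[of \<xi> k]
      by (simp add: abs_mult mult_le_one)
  qed
  have off: "m j k = 0" if "j \<noteq> k"
  proof -
    let ?c = "axis j (1::real)"
    let ?Q = "\<lambda>\<xi>. \<xi> - (2 * (\<xi> \<bullet> ?c)) *\<^sub>R ?c"
    have "orthogonal_transformation ?Q"
      unfolding orthogonal_transformation_def
      by (auto intro!: linearI simp: algebra_simps inner_commute inner_axis_axis scaleR_2)
    moreover have "?c \<in> (Basis :: (real^'n) set)" by (simp add: axis_in_Basis_iff)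
    ultimately have "(LINT \<xi>|sphere_measure. ?Q \<xi> $ j * ?Q \<xi> $ k) = m j k"
      unfolding m_def by (intro integral_sphere_measure_orthogonal lborel_distr_reflection meas)
    moreover have "?Q \<xi> $ j * ?Q \<xi> $ k = - (\<xi> $ j * \<xi> $ k)" for \<xi>
      using that by (simp add: inner_axis) (simp add: axis_def)
    ultimately have "- m j k = m j k" by (simp add: m_def)
    then show ?thesis by simp
  qed
  have diag: "m i i = m j j" for i
  proof -
    let ?t = "Transposition.transpose i j"
    let ?Q = "\<lambda>\<xi>::real^'n. \<chi> l. \<xi> $ ?t l"
    have "(\<Sum>l\<in>UNIV. a $ ?t l * b $ ?t l) = (\<Sum>l\<in>UNIV. a $ l * b $ l)" for a b :: "real^'n"
      by (rule sum.reindex_bij_betw[of ?t UNIV UNIV "\<lambda>l. a $ l * b $ l"]) simp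
    then have Q: "orthogonal_transformation ?Q"
      unfolding orthogonal_transformation_def
      by (auto intro!: linearI simp: vec_eq_iff inner_vec_def)
    have axis: "?Q (axis l 1) = axis (?t l) 1" for l
      by (auto simp: vec_eq_iff axis_def transpose_eq_iff)
    have invol: "?Q (?Q \<xi>) = \<xi>" for \<xi> by (simp add: vec_eq_iff)
    have "?Q b \<in> Basis" if "b \<in> Basis" for b
      using that axis by (auto simp: Basis_vec_def)
    then have "?Q ` Basis = Basis"
      using invol by (auto simp: image_iff) (metis invol)
    from integral_sphere_measure_orthogonal[OF Q lborel_distr_basis_permutation[OF Q invol this] meas, of j j]
    show ?thesis by (simp add: m_def)
  qed
  have "(\<Sum>i\<in>UNIV. m i i) = (LINT \<xi>|sphere_measure. (\<Sum>i\<in>UNIV. \<xi> $ i * (\<xi>::real^'n) $ i))"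
    unfolding m_def using int by (subst Bochner_Integration.integral_sum) auto
  also have "\<dots> = (LINT \<xi>|sphere_measure. norm (\<xi>::real^'n) ^ 2)"
    by (simp add: power2_norm_eq_inner inner_vec_def)
  also have "\<dots> = real CARD('n) * (LINT y|lborel. indicator (punctured_ball 1) y * norm (sgn (y::real^'n)) ^ 2)"
    by (subst integral_sphere_measure) auto
  also have "(LINT y|lborel. indicator (punctured_ball 1) y * norm (sgn (y::real^'n)) ^ 2)
      = (LINT y|lborel. indicator (cball (0::real^'n) 1) y)"
  proof (rule integral_cong_AE)
    have "(\<lambda>y. norm (sgn (y::real^'n))) \<in> borel_measurable lborel"
      using measurable_compose[OF borel_measurable_sgn borel_measurable_norm] by simp
    then show "(\<lambda>y. indicator (punctured_ball 1) y * norm (sgn (y::real^'n)) ^ 2) \<in> borel_measurable lborel"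
      by (intro borel_measurable_times borel_measurable_indicator borel_measurable_power) auto
    show "AE y in lborel. indicator (punctured_ball 1) y * norm (sgn (y::real^'n)) ^ 2 = indicator (cball 0 1) y"
      using AE_lborel_singleton[of "0::real^'n"] by eventually_elim (auto simp: indicator_def norm_sgn)
  qed (simp add: borel_measurable_indicator)
  also have "\<dots> = measure lebesgue (ball (0::real^'n) 1)"
    by (simp add: content_ball content_cball)
  finally have "(\<Sum>i\<in>UNIV. m i i) = real CARD('n) * measure lebesgue (ball (0::real^'n) 1)" .
  moreover have "(\<Sum>i\<in>UNIV. m i i) = (\<Sum>i\<in>(UNIV::'n set). m j j)"
    by (rule sum.cong) (auto intro: diag)
  ultimately have "m j j = measure lebesgue (ball (0::real^'n) 1)" by simp
  then show ?thesis
    using off by (auto simp: m_def)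
qed

section \<open>Borel representatives\<close>

text \<open>In a complete measure space measurability is insensitive to changes on null sets. Both Lebesgue
  measure and the surface measure are completions, and this is how their integrals are reduced to
  Borel functions.\<close>

lemma borel_measurable_completion_AE_cong:
  fixes f g :: "'a \<Rightarrow> 'b::topological_space"
  assumes f: "f \<in> borel_measurable (completion M)" and ae: "AE z in M. f z = g z"
  shows "g \<in> borel_measurable (completion M)"
proof (rule measurableI)
  fix X :: "'b set" assume X: "X \<in> sets borel"
  have N: "{z \<in> space M. f z \<noteq> g z} \<in> null_sets (completion M)"
    using completion.AE_iff_null_sets[THEN iffD1, OF AE_completion[OF ae]] by simp
  have fX: "f -` X \<inter> space M \<in> sets (completion M)"
    using measurable_sets[OF f X] by simp
  have "{z \<in> space M. f z \<noteq> g z \<and> g z \<in> X} \<in> null_sets (completion M)"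
    by (rule completion.complete2[OF _ N]) auto
  then have "(f -` X \<inter> space M) - {z \<in> space M. f z \<noteq> g z} \<union> {z \<in> space M. f z \<noteq> g z \<and> g z \<in> X}
      \<in> sets (completion M)"
    using N fX by auto
  also have "(f -` X \<inter> space M) - {z \<in> space M. f z \<noteq> g z} \<union> {z \<in> space M. f z \<noteq> g z \<and> g z \<in> X}
      = g -` X \<inter> space (completion M)" by auto
  finally show "g -` X \<inter> space (completion M) \<in> sets (completion M)" .
qed simp

lemma completion_integral_AE_cong:
  fixes f g :: "'a \<Rightarrow> 'b::{banach, second_countable_topology}"
  assumes f: "f \<in> borel_measurable M" and ae: "AE z in M. f z = g z"
  shows "(LINT z|completion M. g z) = (LINT z|M. f z)"
    and "integrable (completion M) g \<longleftrightarrow> integrable M f"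
proof -
  have fc: "f \<in> borel_measurable (completion M)" using f by (rule measurable_completion)
  have gc: "g \<in> borel_measurable (completion M)"
    using borel_measurable_completion_AE_cong[OF fc ae] .
  have aec: "AE z in completion M. g z = f z"
    using AE_completion[OF ae] by eventually_elim simp
  show "(LINT z|completion M. g z) = (LINT z|M. f z)"
    using integral_cong_AE[OF gc fc aec] integral_completion[OF f] by simp
  show "integrable (completion M) g \<longleftrightarrow> integrable M f"
    using integrable_cong_AE[OF gc fc aec] integrable_completion[OF f] by simp
qed

lemma completion_ex_borel_measurable_euclidean:
  fixes g :: "'a \<Rightarrow> 'b::euclidean_space"
  assumes g: "g \<in> borel_measurable (completion M)"
  shows "\<exists>g'\<in>borel_measurable M. AE z in M. g' z = g z"
proof -
  have "\<exists>h\<in>borel_measurable M. AE z in M. g z \<bullet> b = h z" for b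
    using g by (intro completion_ex_borel_measurable_real) auto
  then obtain h where h: "\<And>b. h b \<in> borel_measurable M" "\<And>b. AE z in M. g z \<bullet> b = h b z"
    by metis
  have "AE z in M. \<forall>b\<in>Basis. g z \<bullet> b = h b z"
    using h(2) by (intro AE_finite_allI) auto
  then have "AE z in M. (\<Sum>b\<in>Basis. h b z *\<^sub>R b) = g z"
  proof eventually_elim
    case (elim z)
    then have "(\<Sum>b\<in>Basis. h b z *\<^sub>R b) = (\<Sum>b\<in>Basis. (g z \<bullet> b) *\<^sub>R b)"
      by (intro sum.cong) auto
    then show ?case by (simp add: euclidean_representation)
  qed
  moreover have "(\<lambda>z. \<Sum>b\<in>Basis. h b z *\<^sub>R b) \<in> borel_measurable M"
    using h(1) by measurable
  ultimately show ?thesis by (rule bexI)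
qed

lemma lborel_distr_translate: "distr lborel borel ((+) x) = (lborel :: 'a::euclidean_space measure)"
proof -
  have "lborel = density (distr lborel borel (\<lambda>y. x + 1 *\<^sub>R y)) (\<lambda>_. ennreal (\<bar>1::real\<bar> ^ DIM('a)))"
    by (rule lborel_affine) simp
  then show ?thesis by (simp only: density_1 ennreal_1 scaleR_one abs_one power_one)
qed

lemma AE_lborel_translate:
  fixes x :: "'a::euclidean_space"
  assumes "AE y in lborel. P y" shows "AE y in lborel. P (x + y)"
proof -
  have "(+) x \<in> lborel \<rightarrow>\<^sub>M borel" by simp
  from AE_distrD[OF this] show ?thesis
    using assms unfolding lborel_distr_translate by blast
qed

lemma integral_lborel_translate:
  fixes f :: "'a::euclidean_space \<Rightarrow> 'b::{banach, second_countable_topology}"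
  assumes "f \<in> borel_measurable borel"
  shows "(LINT y|lborel. f (x + y)) = (LINT y|lborel. f y)"
    and "integrable lborel (\<lambda>y. f (x + y)) \<longleftrightarrow> integrable lborel f"
proof -
  have "(+) x \<in> lborel \<rightarrow>\<^sub>M borel" by simp
  note * = integral_distr[OF this assms] integrable_distr_eq[OF this assms]
  show "(LINT y|lborel. f (x + y)) = (LINT y|lborel. f y)"
    using *(1) unfolding lborel_distr_translate by (rule sym)
  show "integrable lborel (\<lambda>y. f (x + y)) \<longleftrightarrow> integrable lborel f"
    using *(2) unfolding lborel_distr_translate by (rule sym)
qed

text \<open>The last property transfers every integral over \<open>\<Omega>\<close> whose integrand involves \<open>f\<close> pointwise and is
  supported in the ball; \<open>G\<close> will be multiplication by a radial weight, or the symbol.\<close>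

lemma local_borel_representative:
  fixes f :: "'a::euclidean_space \<Rightarrow> 'b::euclidean_space"
  assumes \<Omega>: "\<Omega> \<in> sets lebesgue" "cball x R \<subseteq> \<Omega>"
    and f: "integrable (lebesgue_on (cball x R)) f"
  obtains f\<^sub>0 where "f\<^sub>0 \<in> borel_measurable borel" "integrable lborel f\<^sub>0"
    "\<forall>y. y \<notin> cball 0 R \<longrightarrow> f\<^sub>0 y = 0"
    "AE y in lborel. y \<in> cball 0 R \<longrightarrow> f\<^sub>0 y = f (x + y)"
    "\<forall>G :: 'a \<Rightarrow> 'b \<Rightarrow> 'c::euclidean_space. (\<lambda>y. G y (f\<^sub>0 y)) \<in> borel_measurable borel \<longrightarrow>
       (\<forall>y z. y \<notin> cball 0 R \<longrightarrow> G y z = 0) \<longrightarrow>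
       (LINT y|lebesgue_on \<Omega>. G (y - x) (f y)) = (LINT y|lborel. G y (f\<^sub>0 y))"
proof -
  let ?g = "\<lambda>y. indicator (cball x R) y *\<^sub>R f y"
  have int: "integrable lebesgue ?g"
    using f by (subst (asm) integrable_restrict_space) auto
  then obtain g where g: "g \<in> borel_measurable borel" "AE y in lborel. g y = ?g y"
    using completion_ex_borel_measurable_euclidean[of ?g lborel] by auto
  define f\<^sub>0 where "f\<^sub>0 y = indicator (cball 0 R) y *\<^sub>R g (x + y)" for y
  have shift: "(\<lambda>y. g (x + y)) \<in> borel_measurable borel"
    using measurable_compose[of "(+) x" borel borel g borel] g(1) by simp
  have meas: "f\<^sub>0 \<in> borel_measurable borel"
    unfolding f\<^sub>0_def using shift by (intro borel_measurable_scaleR borel_measurable_indicator) auto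
  have "integrable lborel g"
    using completion_integral_AE_cong(2)[of g lborel ?g] g int by simp
  then have "integrable lborel (\<lambda>y. g (x + y))"
    using integral_lborel_translate(2)[OF g(1)] by simp
  then have int0: "integrable lborel f\<^sub>0"
    unfolding f\<^sub>0_def by (rule integrable_mult_indicator[rotated]) simp
  have ae: "AE y in lborel. f\<^sub>0 y = indicator (cball 0 R) y *\<^sub>R f (x + y)"
    using AE_lborel_translate[OF g(2), of x]
    by eventually_elim (auto simp: f\<^sub>0_def indicator_def dist_norm)
  show thesis
  proof (rule that[OF meas int0])
    show "\<forall>y. y \<notin> cball 0 R \<longrightarrow> f\<^sub>0 y = 0" by (simp add: f\<^sub>0_def)
    show "AE y in lborel. y \<in> cball 0 R \<longrightarrow> f\<^sub>0 y = f (x + y)"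
      using ae by eventually_elim auto
  next
    show "\<forall>G :: 'a \<Rightarrow> 'b \<Rightarrow> 'c::euclidean_space. (\<lambda>y. G y (f\<^sub>0 y)) \<in> borel_measurable borel \<longrightarrow>
       (\<forall>y z. y \<notin> cball 0 R \<longrightarrow> G y z = 0) \<longrightarrow>
       (LINT y|lebesgue_on \<Omega>. G (y - x) (f y)) = (LINT y|lborel. G y (f\<^sub>0 y))"
    proof (intro allI impI)
      fix G :: "'a \<Rightarrow> 'b \<Rightarrow> 'c" assume G: "(\<lambda>y. G y (f\<^sub>0 y)) \<in> borel_measurable borel"
        "\<forall>y z. y \<notin> cball 0 R \<longrightarrow> G y z = 0"
      let ?h = "\<lambda>y. G (y - x) (f\<^sub>0 (y - x))"
      have h: "?h \<in> borel_measurable borel"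
        using measurable_compose[of "\<lambda>y. y - x" borel borel "\<lambda>y. G y (f\<^sub>0 y)" borel] G(1) by simp
      have "AE y in lborel. f\<^sub>0 (- x + y) = indicator (cball 0 R) (- x + y) *\<^sub>R f (x + (- x + y))"
        using ae by (rule AE_lborel_translate)
      then have "AE y in lborel. ?h y = indicator \<Omega> y *\<^sub>R G (y - x) (f y)"
      proof eventually_elim
        case (elim y)
        show ?case
        proof (cases "y - x \<in> cball 0 R")
          case True
          then have "y \<in> \<Omega>" using \<Omega>(2) by (auto simp: dist_norm norm_minus_commute)
          then show ?thesis using elim True by simp
        qed (use G(2) in simp)
      qed
      then have "(LINT y|lebesgue. indicator \<Omega> y *\<^sub>R G (y - x) (f y)) = (LINT y|lborel. ?h y)"
        using h by (intro completion_integral_AE_cong(1)) auto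
      also have "\<dots> = (LINT y|lborel. G y (f\<^sub>0 y))"
        using integral_lborel_translate(1)[OF h, of x] by simp
      finally show "(LINT y|lebesgue_on \<Omega>. G (y - x) (f y)) = (LINT y|lborel. G y (f\<^sub>0 y))"
        using \<Omega>(1) by (subst integral_restrict_space) auto
    qed
  qed
qed

section \<open>Determining an integrable function from its integrals over rays\<close>

text \<open>The positive and the negative part of \<open>h\<close> are densities of finite measures that agree on all rays, so
  they are the same measure and \<open>h\<close> equals \<open>- h\<close> almost everywhere.\<close>

lemma AE_eq_0_if_integral_ray_eq_0_real:
  fixes h :: "real \<Rightarrow> real"
  assumes h: "integrable lborel h" and ray: "\<And>s. (LINT r|lborel. indicator {s<..} r * h r) = 0"
  shows "AE r in lborel. h r = 0"
proof -
  let ?p = "\<lambda>r. ennreal (h r)" and ?m = "\<lambda>r. ennreal (- h r)"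
  have [measurable]: "h \<in> borel_measurable borel"
    using borel_measurable_integrable[OF h] by simp
  have fin: "(\<integral>\<^sup>+r. ?p r * indicator {s<..} r \<partial>lborel) < \<infinity>" for s
  proof -
    have "(\<integral>\<^sup>+r. ?p r * indicator {s<..} r \<partial>lborel) \<le> (\<integral>\<^sup>+r. ennreal (norm (h r)) \<partial>lborel)"
      by (intro nn_integral_mono) (auto simp: indicator_def ennreal_leI)
    also have "\<dots> < \<infinity>" using h unfolding integrable_iff_bounded by simp
    finally show ?thesis .
  qed
  have "density lborel ?p = density lborel ?m"
  proof (rule measure_eqI_lessThan)
    fix s
    let ?i = "\<lambda>r. indicator {s<..} r * h r"
    have int: "integrable lborel ?i"
      using integrable_mult_indicator[of "{s<..}" lborel h] h by simp
    show "emeasure (density lborel ?p) {s<..} < \<infinity>"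
      using fin by (simp add: emeasure_density)
    have finm: "(\<integral>\<^sup>+r. ennreal (- ?i r) \<partial>lborel) < \<infinity>" and finp: "(\<integral>\<^sup>+r. ennreal (?i r) \<partial>lborel) < \<infinity>"
      using int unfolding real_integrable_def by (auto simp: less_top)
    have "enn2real (\<integral>\<^sup>+r. ennreal (?i r) \<partial>lborel) = enn2real (\<integral>\<^sup>+r. ennreal (- ?i r) \<partial>lborel)"
      using real_lebesgue_integral_def[OF int] ray[of s] by simp
    then have "(\<integral>\<^sup>+r. ennreal (?i r) \<partial>lborel) = (\<integral>\<^sup>+r. ennreal (- ?i r) \<partial>lborel)"
      using finm finp ennreal_enn2real by (metis infinity_ennreal_def)
    moreover have "?p r * indicator {s<..} r = ennreal (?i r)" "?m r * indicator {s<..} r = ennreal (- ?i r)" for r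
      by (auto simp: indicator_def)
    ultimately show "emeasure (density lborel ?p) {s<..} = emeasure (density lborel ?m) {s<..}"
      by (simp add: emeasure_density)
  qed simp_all
  moreover have "(\<integral>\<^sup>+r. ?p r \<partial>lborel) \<noteq> \<infinity>"
    using h unfolding real_integrable_def by auto
  ultimately have "AE r in lborel. ?p r = ?m r"
    using finite_density_unique[of ?p lborel ?m] by simp
  then show ?thesis
  proof eventually_elim
    case (elim r)
    then show ?case by (cases "0 \<le> h r") (auto simp: ennreal_neg dest: sym)
  qed
qed

lemma AE_eq_0_if_integral_ray_eq_0:
  fixes h :: "real \<Rightarrow> 'b::euclidean_space"
  assumes h: "integrable lborel h" and ray: "\<And>s. (LINT r|lborel. indicator {s<..} r *\<^sub>R h r) = 0"
  shows "AE r in lborel. h r = 0"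
proof -
  have "AE r in lborel. h r \<bullet> b = 0" for b
  proof (rule AE_eq_0_if_integral_ray_eq_0_real)
    show "integrable lborel (\<lambda>r. h r \<bullet> b)" using h by simp
    fix s
    have "integrable lborel (\<lambda>r. indicator {s<..} r *\<^sub>R h r)"
      using h by (intro integrable_mult_indicator) auto
    then have "(LINT r|lborel. (indicator {s<..} r *\<^sub>R h r) \<bullet> b)
        = (LINT r|lborel. indicator {s<..} r *\<^sub>R h r) \<bullet> b"
      by (intro integral_inner_left)
    then show "(LINT r|lborel. indicator {s<..} r * (h r \<bullet> b)) = 0"
      by (simp add: ray)
  qed
  then have "AE r in lborel. \<forall>b\<in>Basis. h r \<bullet> b = 0"
    by (intro AE_finite_allI) auto
  then show ?thesis
    by eventually_elim (simp add: euclidean_all_zero_iff)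
qed

section \<open>Layers of balls\<close>

lemma integrable_indicator_Ioc: "integrable lborel (indicator {0<..R::real} :: real \<Rightarrow> real)"
  by (cases "0 \<le> R") auto

text \<open>A radial weight is a superposition of indicators of balls, and Fubini exchanges the integration over
  the radius of the ball with that over the space.\<close>

lemma layer_cake_ball:
  fixes w :: "'a::euclidean_space \<Rightarrow> 'b::euclidean_space"
  assumes w: "integrable lborel w" and g: "g \<in> borel_measurable borel"
    and C: "0 \<le> C" and gb: "\<And>r. \<bar>g r\<bar> \<le> C * indicator {0<..R} r"
  shows "integrable lborel (\<lambda>r. g r *\<^sub>R (LINT y|lborel. indicator (ball 0 r) y *\<^sub>R w y))"
    and "(LINT y|lborel. (LINT r|lborel. g r * indicator {norm y<..} r) *\<^sub>R w y)
      = (LINT r|lborel. g r *\<^sub>R (LINT y|lborel. indicator (ball 0 r) y *\<^sub>R w y))"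
proof -
  have [measurable]: "w \<in> borel_measurable borel" "g \<in> borel_measurable borel"
    using borel_measurable_integrable[OF w] g by simp_all
  let ?F = "\<lambda>r y. (g r * indicator {norm y<..} r) *\<^sub>R w y"
  have F: "(\<lambda>(r, y). ?F r y) \<in> borel_measurable (lborel \<Otimes>\<^sub>M lborel)"
  proof -
    have "(\<lambda>(r, y::'a). indicator {norm y<..} r :: real) = (\<lambda>z. if norm (snd z) < fst z then 1 else 0)"
      by (auto simp: fun_eq_iff)
    also have "\<dots> \<in> borel_measurable (lborel \<Otimes>\<^sub>M lborel)" by measurable
    finally have [measurable]: "(\<lambda>(r, y::'a). indicator {norm y<..} r :: real) \<in> borel_measurable (lborel \<Otimes>\<^sub>M lborel)" .
    have "(\<lambda>z. (g (fst z) * (case z of (r, y) \<Rightarrow> indicator {norm y<..} r)) *\<^sub>R w (snd z))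
        \<in> borel_measurable (lborel \<Otimes>\<^sub>M lborel)" by measurable
    then show ?thesis by (simp add: split_beta)
  qed
  have Fr: "?F r y = g r *\<^sub>R (indicator (ball 0 r) y *\<^sub>R w y)" for r y
    by (simp add: indicator_def)
  have intr: "integrable lborel (\<lambda>y. indicator (ball 0 r) y *\<^sub>R w y)" for r
    using w by (intro integrable_mult_indicator) auto
  have intF: "integrable (lborel \<Otimes>\<^sub>M lborel) (\<lambda>(r, y). ?F r y)"
  proof (rule lborel_pair.Fubini_integrable[OF F])
    show "AE r in lborel. integrable lborel (\<lambda>y. case (r, y) of (r, y) \<Rightarrow> ?F r y)"
      unfolding split_conv Fr using intr by (intro AE_I2 integrable_scaleR_right) auto
    have meas: "(\<lambda>r. LINT y|lborel. norm (?F r y)) \<in> borel_measurable lborel"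
    proof (rule lborel.borel_measurable_lebesgue_integral)
      show "(\<lambda>(r, y). norm (?F r y)) \<in> borel_measurable (lborel \<Otimes>\<^sub>M lborel)"
        using measurable_compose[OF F borel_measurable_norm] unfolding case_prod_beta' .
    qed
    show "integrable lborel (\<lambda>r. LINT y|lborel. norm (case (r, y) of (r, y) \<Rightarrow> ?F r y))"
    proof (rule Bochner_Integration.integrable_bound)
      show "integrable lborel (\<lambda>r. indicator {0<..R} r * (C * (LINT y|lborel. norm (w y))))"
        by (intro integrable_mult_left integrable_indicator_Ioc)
      show "(\<lambda>r. LINT y|lborel. norm (case (r, y) of (r, y) \<Rightarrow> ?F r y)) \<in> borel_measurable lborel"
        using meas by simp
      show "AE r in lborel. norm (LINT y|lborel. norm (case (r, y) of (r, y) \<Rightarrow> ?F r y))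
          \<le> norm (indicator {0<..R} r * (C * (LINT y|lborel. norm (w y))))"
      proof (rule AE_I2)
        fix r
        have "(LINT y|lborel. norm (?F r y)) \<le> (LINT y|lborel. (C * indicator {0<..R} r) * norm (w y))"
        proof (rule integral_mono)
          show "integrable lborel (\<lambda>y. norm (?F r y))"
            unfolding Fr using intr by (intro integrable_norm integrable_scaleR_right) auto
          show "integrable lborel (\<lambda>y. (C * indicator {0<..R} r) * norm (w y))"
            using w by (intro integrable_mult_right integrable_norm) auto
          show "norm (?F r y) \<le> (C * indicator {0<..R} r) * norm (w y)" for y
          proof -
            have "\<bar>g r * indicator {norm y<..} r\<bar> \<le> \<bar>g r\<bar>" by (simp add: indicator_def)
            then have "\<bar>g r * indicator {norm y<..} r\<bar> \<le> C * indicator {0<..R} r" using gb[of r] by linarith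
            then show ?thesis unfolding norm_scaleR real_norm_def by (rule mult_right_mono) simp
          qed
        qed
        moreover have "0 \<le> (LINT y|lborel. norm (?F r y))" by (rule Bochner_Integration.integral_nonneg) simp
        ultimately show "norm (LINT y|lborel. norm (case (r, y) of (r, y) \<Rightarrow> ?F r y))
          \<le> norm (indicator {0<..R} r * (C * (LINT y|lborel. norm (w y))))"
          using C by (simp add: abs_mult mult_ac)
      qed
    qed
  qed
  show "integrable lborel (\<lambda>r. g r *\<^sub>R (LINT y|lborel. indicator (ball 0 r) y *\<^sub>R w y))"
    using lborel_pair.integrable_fst[OF intF] unfolding Fr integral_scaleR_right .
  have "(LINT y|lborel. (LINT r|lborel. ?F r y)) = (LINT r|lborel. (LINT y|lborel. ?F r y))"
    using lborel_pair.Fubini_integral[OF intF] .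
  moreover have "(LINT r|lborel. ?F r y) = (LINT r|lborel. g r * indicator {norm y<..} r) *\<^sub>R w y" for y
  proof -
    have "integrable lborel (\<lambda>r. g r * indicator {norm y<..} r)"
    proof (rule Bochner_Integration.integrable_bound)
      show "integrable lborel (\<lambda>r. C * indicator {0<..R} r :: real)"
        by (intro integrable_mult_right integrable_indicator_Ioc)
      show "(\<lambda>r. g r * indicator {norm y<..} r) \<in> borel_measurable lborel" by measurable
      show "AE r in lborel. norm (g r * indicator {norm y<..} r) \<le> norm (C * indicator {0<..R} r :: real)"
      proof (rule AE_I2)
        fix r
        have "\<bar>g r * indicator {norm y<..} r\<bar> \<le> \<bar>g r\<bar>" by (simp add: indicator_def)
        then show "norm (g r * indicator {norm y<..} r) \<le> norm (C * indicator {0<..R} r :: real)"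
          using gb[of r] by simp
      qed
    qed
    then show ?thesis by (intro integral_scaleR_left)
  qed
  ultimately show "(LINT y|lborel. (LINT r|lborel. g r * indicator {norm y<..} r) *\<^sub>R w y)
      = (LINT r|lborel. g r *\<^sub>R (LINT y|lborel. indicator (ball 0 r) y *\<^sub>R w y))"
    unfolding Fr integral_scaleR_right by simp
qed

section \<open>The divergence theorem on almost every sphere\<close>

text \<open>Let \<open>G(r)\<close> be the integral of \<open>\<A>(\<xi>) u(r \<xi>)\<close> over the sphere and \<open>W(r)\<close> that of \<open>w\<close> over the ball. The weak equation, tested with
  \<open>\<theta>(|y|\<^sup>2)\<close> where \<open>\<theta>\<close> is the primitive of a bump that vanishes at \<open>R\<^sup>2\<close>, says that
  \<open>2 r bump(r\<^sup>2) (W(r) - r\<^sup>n\<^sup>-\<^sup>1 G(r))\<close> has integral zero: the layer cake formula treats the side of \<open>w\<close>,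
  polar coordinates the side of \<open>u\<close>. The bumps exhaust the interval from \<open>a\<close> to \<open>R\<^sup>2\<close>, hence
  \<open>2 r (W(r) - r\<^sup>n\<^sup>-\<^sup>1 G(r))\<close> integrates to zero over every ray and vanishes almost everywhere.\<close>

lemma sphere_mean_eq_ball_integral_borel:
  fixes A :: "'n::finite \<Rightarrow> 'e::euclidean_space \<Rightarrow>\<^sub>L 'f::euclidean_space"
    and u :: "real^'n \<Rightarrow> 'e" and w :: "real^'n \<Rightarrow> 'f"
  assumes R: "0 < R"
    and u: "u \<in> borel_measurable borel" "integrable lborel u" "\<And>y. y \<notin> cball 0 R \<Longrightarrow> u y = 0"
    and w: "w \<in> borel_measurable borel" "integrable lborel w" "\<And>y. y \<notin> cball 0 R \<Longrightarrow> w y = 0"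
    and weak: "\<And>a k \<theta>. a < R^2 \<Longrightarrow> (\<And>s. (\<theta> has_real_derivative bump a (R^2) k s) (at s)) \<Longrightarrow> \<theta> (R^2) = 0 \<Longrightarrow>
      (LINT y|lborel. \<theta> (norm y ^ 2) *\<^sub>R w y)
        = - (LINT y|lborel. (2 * bump a (R^2) k (norm y ^ 2)) *\<^sub>R symbol A y (u y))"
  shows "AE r in lborel. 0 < r \<and> r \<le> R \<longrightarrow>
    r ^ (CARD('n) - 1) *\<^sub>R (LINT \<xi>|sphere_measure. symbol A \<xi> (u (r *\<^sub>R \<xi>)))
      = (LINT y|lborel. indicator (ball 0 r) y *\<^sub>R w y)"
proof -
  let ?n = "CARD('n)" and ?K = "restrict_space lborel (punctured_ball R) :: (real^'n) measure"
  define f where "f y = symbol A (sgn y) (u y)" for y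
  define G where "G r = (LINT \<xi>|sphere_measure. f (r *\<^sub>R \<xi>))" for r
  define W where "W r = (LINT y|lborel. indicator (ball 0 r) y *\<^sub>R w y)" for r
  define \<rho> where "\<rho> r = r ^ (?n - 1) * indicator {0<..R} r" for r :: real
  define h where "h r = (2 * r * indicator {0<..R} r) *\<^sub>R W r - (2 * r * \<rho> r) *\<^sub>R G r" for r
  have f: "f \<in> borel_measurable borel"
    unfolding f_def using borel_measurable_sgn u(1) by (rule borel_measurable_symbol_apply)
  have intf: "integrable lborel f"
  proof (rule Bochner_Integration.integrable_bound)
    show "integrable lborel (\<lambda>y. (\<Sum>j\<in>UNIV. norm (A j)) * norm (u y))"
      using u(2) by (intro integrable_mult_right integrable_norm)
    show "AE y in lborel. norm (f y) \<le> norm ((\<Sum>j\<in>UNIV. norm (A j)) * norm (u y))"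
    proof (rule AE_I2)
      fix y
      have "norm (f y) \<le> (\<Sum>j\<in>UNIV. norm (A j)) * norm (u y)"
        unfolding f_def by (rule norm_symbol_apply_le) (simp add: norm_sgn)
      then show "norm (f y) \<le> norm ((\<Sum>j\<in>UNIV. norm (A j)) * norm (u y))" by simp
    qed
  qed (use f in simp)
  have radial: "radial_measure ?n R = density lborel (\<lambda>r. ennreal (\<rho> r))"
    unfolding radial_measure_def \<rho>_def by (intro density_cong) (auto simp: indicator_def intro!: AE_I2)
  have \<rho>: "\<rho> \<in> borel_measurable lborel" "AE r in lborel. 0 \<le> \<rho> r"
    unfolding \<rho>_def by (auto simp: indicator_def)
  have restr: "integrable ?K F" if "integrable lborel F" for F :: "real^'n \<Rightarrow> 'f"
    using that by (subst integrable_restrict_space) (auto intro: integrable_mult_indicator)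
  have "integrable (radial_measure ?n R) G"
    unfolding G_def by (rule polar_integral(2)[OF R f restr[OF intf]])
  then have G: "G \<in> borel_measurable borel" and intG: "integrable lborel (\<lambda>r. \<rho> r *\<^sub>R G r)"
  proof -
    assume int: "integrable (radial_measure ?n R) G"
    show "G \<in> borel_measurable borel"
      using borel_measurable_integrable[OF int] by (simp cong: measurable_cong_sets)
    then show "integrable lborel (\<lambda>r. \<rho> r *\<^sub>R G r)"
      using int \<rho> unfolding radial by (subst (asm) integrable_density) auto
  qed
  have times: "integrable lborel (\<lambda>r. (2 * r) *\<^sub>R F r)"
    if F: "integrable lborel F" "\<And>r. r \<notin> {0<..R} \<Longrightarrow> F r = 0" for F :: "real \<Rightarrow> 'f"
  proof (rule Bochner_Integration.integrable_bound)
    show "integrable lborel (\<lambda>r. (2 * R) * norm (F r))" using F by (intro integrable_mult_right integrable_norm)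
    show "(\<lambda>r. (2 * r) *\<^sub>R F r) \<in> borel_measurable lborel"
      using borel_measurable_integrable[OF F(1)] by measurable
    show "AE r in lborel. norm ((2 * r) *\<^sub>R F r) \<le> norm ((2 * R) * norm (F r))"
    proof (rule AE_I2)
      show "norm ((2 * r) *\<^sub>R F r) \<le> norm ((2 * R) * norm (F r))" for r
        using F(2)[of r] R by (cases "r \<in> {0<..R}") (auto simp: abs_mult intro!: mult_right_mono)
    qed
  qed
  have c_bound: "\<bar>2 * r * indicator {0<..R} r * b\<bar> \<le> 2 * R * indicator {0<..R} r" if "0 \<le> b" "b \<le> 1" for r b :: real
    using that R by (auto simp: indicator_def abs_mult intro!: mult_le_one mult_mono[of "2 * r" "2 * R" b 1, simplified])
  have intW: "integrable lborel (\<lambda>r. (2 * r * indicator {0<..R} r) *\<^sub>R W r)"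
    unfolding W_def
    by (rule layer_cake_ball(1)[OF w(2), where C = "2 * R" and R = R]) (use c_bound[of 1] R in auto)
  have inth: "integrable lborel h"
    using times[OF intG] intW unfolding h_def
    by (intro Bochner_Integration.integrable_diff) (auto simp: \<rho>_def)
  have bump_h: "(LINT r|lborel. bump a (R^2) k (r^2) *\<^sub>R h r) = 0" if "a < R^2" for a k
  proof -
    let ?b = "\<lambda>r. bump a (R^2) k (r^2)"
    have contb: "continuous_on X ?b" for X :: "real set"
      by (rule continuous_on_compose2[OF continuous_bump[of UNIV]]) (auto intro: continuous_intros)
    have [measurable]: "?b \<in> borel_measurable borel"
      by (rule borel_measurable_continuous_onI[OF contb])
    obtain \<Theta> where \<Theta>: "\<And>s. (\<Theta> has_real_derivative bump a (R^2) k s) (at s)"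
      using einterval_antiderivative[of "-\<infinity>" "\<infinity>" "bump a (R^2) k"] continuous_bump[of UNIV a "R^2" k]
      by (auto simp: continuous_on_eq_continuous_at has_real_derivative_iff_has_vector_derivative)
    define \<theta> where "\<theta> s = \<Theta> s - \<Theta> (R^2)" for s
    have \<theta>: "(\<theta> has_real_derivative bump a (R^2) k s) (at s)" "\<theta> (R^2) = 0" for s
      unfolding \<theta>_def using \<Theta>[of s] by (auto intro!: derivative_eq_intros)
    let ?c = "\<lambda>r. 2 * r * indicator {0<..R} r * ?b r"
    have cake: "(LINT r|lborel. ?c r *\<^sub>R W r) = - (LINT y|lborel. \<theta> (norm y ^ 2) *\<^sub>R w y)"
    proof -
      have "(LINT r|lborel. ?c r * indicator {norm y<..} r) *\<^sub>R w y = - (\<theta> (norm y ^ 2) *\<^sub>R w y)" for y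
      proof (cases "norm y \<le> R")
        case True
        have "(LINT r|lborel. ?c r * indicator {norm y<..} r)
            = (LINT r|lborel. (2 * r * ?b r) * indicator {norm y..R} r)"
        proof (rule integral_cong_AE)
          show "AE r in lborel. ?c r * indicator {norm y<..} r = (2 * r * ?b r) * indicator {norm y..R} r"
            using AE_lborel_singleton[of "norm y"]
          proof eventually_elim
            case (elim r)
            moreover have "norm y < r \<Longrightarrow> 0 < r" using norm_ge_zero[of y] by linarith
            ultimately show ?case by (cases "norm y < r") (auto simp: indicator_def)
          qed
        qed measurable
        also have "\<dots> = \<theta> (R ^ 2) - \<theta> (norm y ^ 2)"
        proof (rule integral_FTC_Icc_nonneg)
          fix r assume r: "r \<in> {norm y..R}"
          have "((\<lambda>r. \<theta> (r^2)) has_real_derivative bump a (R^2) k (r^2) * (2 * r)) (at r)"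
            by (rule DERIV_chain2[OF \<theta>(1)]) (auto intro!: derivative_eq_intros)
          then show "((\<lambda>r. \<theta> (r^2)) has_real_derivative 2 * r * ?b r) (at r)" by (simp add: mult_ac)
          show "0 \<le> 2 * r * ?b r" using r order_trans[OF norm_ge_zero[of y]] bump_bounds(1) by simp
        qed (use True in auto)
        finally show ?thesis using \<theta>(2) by simp
      qed (use w(3) in auto)
      moreover have "(LINT y|lborel. (LINT r|lborel. ?c r * indicator {norm y<..} r) *\<^sub>R w y) = (LINT r|lborel. ?c r *\<^sub>R W r)"
        unfolding W_def
        by (rule layer_cake_ball(2)[OF w(2), where C = "2 * R" and R = R]) (use R c_bound bump_bounds in auto)
      ultimately show ?thesis by simp
    qed
    have polar: "(LINT r|lborel. (2 * r * \<rho> r * ?b r) *\<^sub>R G r)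
        = (LINT y|lborel. (2 * ?b (norm y)) *\<^sub>R symbol A y (u y))"
    proof -
      let ?f = "\<lambda>y. (2 * norm y * ?b (norm y)) *\<^sub>R f y"
      have mf: "?f \<in> borel_measurable borel" using f by measurable
      have "integrable ?K ?f"
      proof (rule Bochner_Integration.integrable_bound)
        show "integrable ?K (\<lambda>y. (2 * R) *\<^sub>R f y)" using restr[OF intf] by simp
        show "?f \<in> borel_measurable ?K" using mf by (intro measurable_restrict_space1) simp
        show "AE y in ?K. norm (?f y) \<le> norm ((2 * R) *\<^sub>R f y)"
        proof (rule AE_I2)
          fix y assume "y \<in> space ?K"
          then have "norm y \<le> R" by (simp add: space_restrict_space)
          then have "norm y * ?b (norm y) \<le> R * 1" using bump_bounds R by (intro mult_mono) auto
          then have "\<bar>2 * norm y * ?b (norm y)\<bar> \<le> \<bar>2 * R\<bar>"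
            using R bump_bounds(1)[of a "R^2" k] by (simp add: abs_mult)
          then show "norm (?f y) \<le> norm ((2 * R) *\<^sub>R f y)"
            unfolding norm_scaleR by (rule mult_right_mono) simp
        qed
      qed
      note polar_integral(3)[OF R mf this]
      also have "(\<lambda>r. LINT \<xi>|sphere_measure. ?f (r *\<^sub>R \<xi>)) = (\<lambda>r. (2 * \<bar>r\<bar> * ?b \<bar>r\<bar>) *\<^sub>R G r)"
      proof
        fix r
        have "(LINT \<xi>|sphere_measure. ?f (r *\<^sub>R \<xi>)) = (LINT \<xi>|sphere_measure. (2 * \<bar>r\<bar> * ?b \<bar>r\<bar>) *\<^sub>R f (r *\<^sub>R (\<xi>::real^'n)))"
          by (rule Bochner_Integration.integral_cong) auto
        then show "(LINT \<xi>|sphere_measure. ?f (r *\<^sub>R \<xi>)) = (2 * \<bar>r\<bar> * ?b \<bar>r\<bar>) *\<^sub>R G r"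
          by (simp add: G_def)
      qed
      also have "(LINT r|radial_measure ?n R. (2 * \<bar>r\<bar> * ?b \<bar>r\<bar>) *\<^sub>R G r)
          = (LINT r|lborel. \<rho> r *\<^sub>R ((2 * \<bar>r\<bar> * ?b \<bar>r\<bar>) *\<^sub>R G r))"
        unfolding radial using G \<rho> by (intro integral_density) auto
      also have "\<dots> = (LINT r|lborel. (2 * r * \<rho> r * ?b r) *\<^sub>R G r)"
        by (rule Bochner_Integration.integral_cong) (auto simp: \<rho>_def indicator_def mult_ac)
      also have "(LINT y|?K. ?f y) = (LINT y|lborel. indicator (punctured_ball R) y *\<^sub>R ?f y)"
        by (rule integral_restrict_space) simp
      also have "\<dots> = (LINT y|lborel. (2 * ?b (norm y)) *\<^sub>R symbol A y (u y))"
      proof (rule Bochner_Integration.integral_cong)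
        fix y
        have "norm y *\<^sub>R f y = symbol A y (u y)"
          unfolding f_def symbol_scaleR[symmetric] by simp
        moreover have "?f y = (2 * ?b (norm y)) *\<^sub>R (norm y *\<^sub>R f y)"
          by (simp add: mult_ac)
        ultimately have "?f y = (2 * ?b (norm y)) *\<^sub>R symbol A y (u y)" by metis
        moreover have "symbol A y (u y) = 0" if "y \<notin> punctured_ball R"
          using that u(3) by (auto simp: symbol_apply blinfun.zero_right)
        ultimately show "indicator (punctured_ball R) y *\<^sub>R ?f y = (2 * ?b (norm y)) *\<^sub>R symbol A y (u y)"
          by (cases "y \<in> punctured_ball R") auto
      qed simp
      finally show ?thesis by simp
    qed
    have bound: "integrable lborel (\<lambda>r. ?b r *\<^sub>R F r)" if F: "integrable lborel F" for F :: "real \<Rightarrow> 'f"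
    proof (rule Bochner_Integration.integrable_bound[OF F])
      show "(\<lambda>r. ?b r *\<^sub>R F r) \<in> borel_measurable lborel"
        using borel_measurable_integrable[OF F] by measurable
      show "AE r in lborel. norm (?b r *\<^sub>R F r) \<le> norm (F r)"
        using bump_bounds by (intro AE_I2) (auto intro!: mult_left_le_one_le)
    qed
    have "(LINT r|lborel. ?b r *\<^sub>R h r)
        = (LINT r|lborel. ?b r *\<^sub>R ((2 * r * indicator {0<..R} r) *\<^sub>R W r))
          - (LINT r|lborel. ?b r *\<^sub>R ((2 * r) *\<^sub>R (\<rho> r *\<^sub>R G r)))"
    proof -
      have "integrable lborel (\<lambda>r. (2 * r) *\<^sub>R (\<rho> r *\<^sub>R G r))"
        by (rule times[OF intG]) (auto simp: \<rho>_def)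
      from Bochner_Integration.integral_diff[OF bound[OF intW] bound[OF this]]
      show ?thesis by (simp add: h_def scaleR_diff_right mult.assoc)
    qed
    also have "\<dots> = (LINT r|lborel. ?c r *\<^sub>R W r) - (LINT r|lborel. (2 * r * \<rho> r * ?b r) *\<^sub>R G r)"
      by (simp add: mult_ac)
    also have "\<dots> = 0"
      unfolding cake polar using weak[OF that \<theta>] by simp
    finally show ?thesis .
  qed
  have "AE r in lborel. h r = 0"
  proof (rule AE_eq_0_if_integral_ray_eq_0[OF inth])
    fix s
    have h0: "h r = 0" if "r \<notin> {0<..R}" for r using that by (simp add: h_def \<rho>_def)
    show "(LINT r|lborel. indicator {s<..} r *\<^sub>R h r) = 0"
    proof (cases "s < R")
      case False
      then have "(\<lambda>r. indicator {s<..} r *\<^sub>R h r) = (\<lambda>_. 0)"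
        using h0 by (auto simp: indicator_def)
      then show ?thesis by simp
    next
      case True
      \<comment> \<open>\<open>a\<close> is chosen such that \<open>a < r\<^sup>2\<close> and \<open>s < r\<close> are equivalent for positive \<open>r\<close>; any negative number
        serves for negative \<open>s\<close>.\<close>
      define a where "a = (if s < 0 then - 1 else s^2)"
      have a: "a < R^2"
      proof (cases "s < 0")
        case True
        have "- 1 < R^2" using zero_le_power2[of R] by linarith
        then show ?thesis using True by (simp add: a_def)
      next
        case False
        then show ?thesis using \<open>s < R\<close> power_strict_mono[of s R 2] by (simp add: a_def)
      qed
      have iff: "a < r^2 \<longleftrightarrow> s < r" if "0 < r" for r
      proof (cases "s < 0")
        case True
        moreover have "- 1 < r^2" using zero_le_power2[of r] by linarith
        ultimately show ?thesis using that by (simp add: a_def)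
      next
        case False
        then show ?thesis
          using that power_strict_mono[of s r 2] power_less_imp_less_base[of s 2 r] by (auto simp: a_def)
      qed
      have "(\<lambda>k. LINT r|lborel. bump a (R^2) k (r^2) *\<^sub>R h r) \<longlonglongrightarrow> (LINT r|lborel. indicator {s<..} r *\<^sub>R h r)"
      proof (rule integral_dominated_convergence[where w = "\<lambda>r. norm (h r)"])
        have hm: "h \<in> borel_measurable lborel" using borel_measurable_integrable[OF inth] .
        then show "(\<lambda>r. indicator {s<..} r *\<^sub>R h r) \<in> borel_measurable lborel" by measurable
        show "(\<lambda>r. bump a (R^2) k (r^2) *\<^sub>R h r) \<in> borel_measurable lborel" for k
        proof -
          have "continuous_on UNIV (\<lambda>r. bump a (R^2) k (r^2))"
            by (rule continuous_on_compose2[OF continuous_bump[of UNIV]]) (auto intro: continuous_intros)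
          then have "(\<lambda>r. bump a (R^2) k (r^2)) \<in> borel_measurable borel"
            by (rule borel_measurable_continuous_onI)
          then show ?thesis using hm by simp
        qed
        show "integrable lborel (\<lambda>r. norm (h r))" using inth by simp
        show "AE r in lborel. norm (bump a (R^2) k (r^2) *\<^sub>R h r) \<le> norm (h r)" for k
          using bump_bounds by (intro AE_I2) (auto intro!: mult_left_le_one_le)
        show "AE r in lborel. (\<lambda>k. bump a (R^2) k (r^2) *\<^sub>R h r) \<longlonglongrightarrow> indicator {s<..} r *\<^sub>R h r"
          \<comment> \<open>The bumps vanish at \<open>R\<^sup>2\<close>, so the single radius \<open>R\<close> is exempt.\<close>
          using AE_lborel_singleton[of R]
        proof eventually_elim
          case (elim r)
          show ?case
          proof (cases "r \<in> {0<..R}")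
            case r: True
            then have "r^2 < R^2" using elim by (auto intro!: power_strict_mono)
            then have "indicator {a<..<R^2} (r^2) = (indicator {s<..} r :: real)"
              using iff[of r] r by (auto simp: indicator_def)
            then show ?thesis
              using tendsto_scaleR[OF bump_tendsto_indicator[of a "R^2" "r^2"] tendsto_const[of "h r"]] by simp
          qed (use h0 in simp)
        qed
      qed
      then show ?thesis
        unfolding bump_h[OF a] by (simp add: LIMSEQ_const_iff)
    qed
  qed
  then show ?thesis
  proof eventually_elim
    case (elim r)
    show ?case
    proof
      assume r: "0 < r \<and> r \<le> R"
      have "G r = (LINT \<xi>|sphere_measure. symbol A \<xi> (u (r *\<^sub>R \<xi>)))"
        unfolding G_def f_def
        by (rule Bochner_Integration.integral_cong) (use r in \<open>auto simp: sgn_div_norm\<close>)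
      moreover have "(2 * r) *\<^sub>R (W r - r ^ (?n - 1) *\<^sub>R G r) = 0"
        using elim r by (simp add: h_def \<rho>_def scaleR_diff_right mult_ac)
      ultimately show "r ^ (?n - 1) *\<^sub>R (LINT \<xi>|sphere_measure. symbol A \<xi> (u (r *\<^sub>R \<xi>)))
          = (LINT y|lborel. indicator (ball 0 r) y *\<^sub>R w y)"
        using r by (simp add: W_def)
    qed
  qed
qed

lemma finite_measure_surface_measure: "finite_measure (surface_measure :: (real^'n) measure)"
proof
  have "sphere 0 1 \<in> sets (sphere_measure :: (real^'n) measure)"
    using sets.top[of "sphere_measure :: (real^'n) measure"] by simp
  then have "emeasure surface_measure (sphere 0 1 :: (real^'n) set) = emeasure sphere_measure (sphere 0 1 :: (real^'n) set)"
    unfolding surface_measure_completion by simp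
  then show "emeasure surface_measure (space (surface_measure :: (real^'n) measure)) \<noteq> \<infinity>"
    using finite_measure.emeasure_finite[OF finite_measure_sphere_measure]
    by (simp add: surface_measure_completion)
qed

lemma space_surface_measure [simp]: "space surface_measure = sphere 0 1"
  by (simp add: surface_measure_completion)

lemma integrable_surface_measure_bounded:
  fixes f :: "real^'n \<Rightarrow> 'b::{banach, second_countable_topology}"
  assumes "f \<in> borel_measurable borel" "\<And>\<xi>. norm \<xi> = 1 \<Longrightarrow> norm (f \<xi>) \<le> K"
  shows "integrable surface_measure f"
  using integrable_sphere_measure_bounded[OF assms] borel_measurable_sphere_measure[OF assms(1)]
  unfolding surface_measure_completion by (simp add: integrable_completion)

text \<open>Finiteness of the measure enters through \<open>t \<le> 1 + t\<^sup>p\<close>.\<close>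

lemma in_Lp_integrable:
  assumes "finite_measure M" "1 \<le> p" "in_Lp p M f"
  shows "integrable M f"
proof (rule Bochner_Integration.integrable_bound)
  show "integrable M (\<lambda>z. 1 + norm (f z) powr p)"
    using assms finite_measure.integrable_const[of M "1::real"] unfolding in_Lp_def by auto
  show "AE z in M. norm (f z) \<le> norm (1 + norm (f z) powr p)"
  proof (rule AE_I2)
    fix z
    have "norm (f z) \<le> 1 + norm (f z) powr p"
    proof (cases "norm (f z) \<le> 1")
      case False
      then have "norm (f z) powr 1 \<le> norm (f z) powr p" using assms(2) by (intro powr_mono) auto
      then show ?thesis using False by simp
    qed (simp add: add_increasing2)
    then show "norm (f z) \<le> norm (1 + norm (f z) powr p)" by simp
  qed
qed (use assms in \<open>simp add: in_Lp_def\<close>)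

lemma in_Lp_integrable_on_cball:
  fixes f :: "'a::euclidean_space \<Rightarrow> 'b::euclidean_space"
  assumes "1 \<le> p" "in_Lp p (lebesgue_on \<Omega>) f" "\<Omega> \<in> sets lebesgue" "cball x R \<subseteq> \<Omega>"
  shows "integrable (lebesgue_on (cball x R)) f"
proof (rule in_Lp_integrable[OF _ assms(1)])
  show "finite_measure (lebesgue_on (cball x R))" by (rule finite_measure_lebesgue_on) simp
  have "integrable lebesgue (\<lambda>y. indicator \<Omega> y *\<^sub>R (norm (f y) powr p))"
    using assms(2,3) unfolding in_Lp_def by (subst (asm) integrable_restrict_space) auto
  then have "integrable lebesgue (\<lambda>y. indicator (cball x R) y *\<^sub>R (indicator \<Omega> y *\<^sub>R (norm (f y) powr p)))"
    by (rule integrable_mult_indicator[rotated]) simp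
  moreover have "(\<lambda>y. indicator (cball x R) y *\<^sub>R (indicator \<Omega> y *\<^sub>R (norm (f y) powr p)))
      = (\<lambda>y. indicator (cball x R) y *\<^sub>R (norm (f y) powr p))"
    using assms(4) by (auto simp: indicator_def fun_eq_iff)
  ultimately have "integrable lebesgue (\<lambda>y. indicator (cball x R) y *\<^sub>R (norm (f y) powr p))"
    by (simp only:)
  then have "integrable (lebesgue_on (cball x R)) (\<lambda>y. norm (f y) powr p)"
    by (subst integrable_restrict_space) auto
  moreover have "f \<in> borel_measurable (lebesgue_on (cball x R))"
    using assms(2,4) unfolding in_Lp_def by (blast intro: measurable_restrict_mono)
  ultimately show "in_Lp p (lebesgue_on (cball x R)) f" by (simp add: in_Lp_def)
qed

text \<open>This is the divergence theorem for the distributional operator: after recentring at \<open>x\<close> and passing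
  to Borel representatives the previous lemma applies, and by \<open>AE_polar\<close> the representative of \<open>u\<close> can
  be exchanged for \<open>u\<close> itself on almost every sphere.\<close>

lemma sphere_mean_eq_ball_integral:
  fixes A :: "'n::finite \<Rightarrow> 'e::euclidean_space \<Rightarrow>\<^sub>L 'f::euclidean_space"
    and u :: "real^'n \<Rightarrow> 'e" and w :: "real^'n \<Rightarrow> 'f"
  assumes "1 \<le> p" and \<Omega>: "\<Omega> \<in> sets lebesgue" "cball x R \<subseteq> \<Omega>" and R: "0 < R"
    and u: "in_Lp p (lebesgue_on \<Omega>) u" and w: "weak_image p \<Omega> A u w"
  shows "AE r in lborel. 0 < r \<and> r \<le> R \<longrightarrow> integrable surface_measure (\<lambda>\<xi>. u (x + r *\<^sub>R \<xi>)) \<and>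
    r ^ (CARD('n) - 1) *\<^sub>R (LINT \<xi>|surface_measure. symbol A \<xi> (u (x + r *\<^sub>R \<xi>)))
      = (LINT y|lebesgue_on (ball x r). w y)"
proof -
  have intu: "integrable (lebesgue_on (cball x R)) u"
    using assms(1) u \<Omega> by (rule in_Lp_integrable_on_cball)
  have intw: "integrable (lebesgue_on (cball x R)) w"
    using assms(1) _ \<Omega> by (rule in_Lp_integrable_on_cball) (use w in \<open>simp add: weak_image_def\<close>)
  obtain u\<^sub>0 where u\<^sub>0: "u\<^sub>0 \<in> borel_measurable borel" "integrable lborel u\<^sub>0"
    "\<forall>y. y \<notin> cball 0 R \<longrightarrow> u\<^sub>0 y = 0"
    "AE y in lborel. y \<in> cball 0 R \<longrightarrow> u\<^sub>0 y = u (x + y)"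
    "\<forall>G :: real^'n \<Rightarrow> 'e \<Rightarrow> 'f. (\<lambda>y. G y (u\<^sub>0 y)) \<in> borel_measurable borel \<longrightarrow>
       (\<forall>y z. y \<notin> cball 0 R \<longrightarrow> G y z = 0) \<longrightarrow>
       (LINT y|lebesgue_on \<Omega>. G (y - x) (u y)) = (LINT y|lborel. G y (u\<^sub>0 y))"
    by (rule local_borel_representative[OF \<Omega> intu, where 'c = 'f])
  obtain w\<^sub>0 where w\<^sub>0: "w\<^sub>0 \<in> borel_measurable borel" "integrable lborel w\<^sub>0"
    "\<forall>y. y \<notin> cball 0 R \<longrightarrow> w\<^sub>0 y = 0"
    "AE y in lborel. y \<in> cball 0 R \<longrightarrow> w\<^sub>0 y = w (x + y)"
    "\<forall>G :: real^'n \<Rightarrow> 'f \<Rightarrow> 'f. (\<lambda>y. G y (w\<^sub>0 y)) \<in> borel_measurable borel \<longrightarrow>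
       (\<forall>y z. y \<notin> cball 0 R \<longrightarrow> G y z = 0) \<longrightarrow>
       (LINT y|lebesgue_on \<Omega>. G (y - x) (w y)) = (LINT y|lborel. G y (w\<^sub>0 y))"
    by (rule local_borel_representative[OF \<Omega> intw, where 'c = 'f])
  have weak: "(LINT y|lborel. \<theta> (norm y ^ 2) *\<^sub>R w\<^sub>0 y)
      = - (LINT y|lborel. (2 * bump a (R^2) k (norm y ^ 2)) *\<^sub>R symbol A y (u\<^sub>0 y))"
    if \<theta>: "\<And>s. (\<theta> has_real_derivative bump a (R^2) k s) (at s)" "\<theta> (R^2) = 0" for a k \<theta>
  proof -
    have ball: "cball x (sqrt (R^2)) \<subseteq> \<Omega>" using \<Omega>(2) R by simp
    have far: "R^2 \<le> norm y ^ 2" if "y \<notin> cball 0 R" for y :: "real^'n"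
      using that R by (auto intro!: power_mono)
    have "continuous_on UNIV \<theta>"
      using \<theta>(1) DERIV_isCont by (blast intro: continuous_at_imp_continuous_on)
    then have [measurable]: "\<theta> \<in> borel_measurable borel" "bump a (R^2) k \<in> borel_measurable borel"
      using continuous_bump[of UNIV] by (auto intro: borel_measurable_continuous_onI)
    have meas: "(\<lambda>y::real^'n. \<theta> (norm y ^ 2)) \<in> borel_measurable borel"
      "(\<lambda>y::real^'n. bump a (R^2) k (norm y ^ 2)) \<in> borel_measurable borel"
      by measurable
    have "(LINT y|lborel. \<theta> (norm y ^ 2) *\<^sub>R w\<^sub>0 y)
        = (LINT y|lebesgue_on \<Omega>. \<theta> (norm (y - x) ^ 2) *\<^sub>R w y)"
      by (rule w\<^sub>0(5)[rule_format, symmetric]) (use meas w\<^sub>0(1) bump_primitive_eq_0[OF \<theta> far] in auto)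
    also have "\<dots> = - (LINT y|lebesgue_on \<Omega>.
        (\<Sum>j\<in>UNIV. partial_deriv j (\<lambda>y. \<theta> (norm (y - x) ^ 2)) y *\<^sub>R A j (u y)))"
      using w radial_test_function(1)[OF ball \<theta>] unfolding weak_image_def by blast
    also have "\<dots> = - (LINT y|lebesgue_on \<Omega>. (2 * bump a (R^2) k (norm (y - x) ^ 2)) *\<^sub>R symbol A (y - x) (u y))"
    proof -
      have "(\<Sum>j\<in>UNIV. partial_deriv j (\<lambda>y. \<theta> (norm (y - x) ^ 2)) y *\<^sub>R A j (u y))
          = (2 * bump a (R^2) k (norm (y - x) ^ 2)) *\<^sub>R symbol A (y - x) (u y)" for y
        unfolding radial_test_function(2)[OF ball \<theta>] symbol_apply scaleR_sum_right
        by (rule sum.cong) (simp_all add: algebra_simps)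
      then show ?thesis by simp
    qed
    also have "(LINT y|lebesgue_on \<Omega>. (2 * bump a (R^2) k (norm (y - x) ^ 2)) *\<^sub>R symbol A (y - x) (u y))
        = (LINT y|lborel. (2 * bump a (R^2) k (norm y ^ 2)) *\<^sub>R symbol A y (u\<^sub>0 y))"
      by (rule u\<^sub>0(5)[rule_format])
        (use meas far borel_measurable_symbol_apply[OF _ u\<^sub>0(1), of "\<lambda>y. y" A] bump_eq_0 in auto)
    finally show ?thesis .
  qed
  have W: "(LINT y|lebesgue_on (ball x r). w y) = (LINT y|lborel. indicator (ball 0 r) y *\<^sub>R w\<^sub>0 y)"
    if "r \<le> R" for r
  proof -
    have sub: "ball x r \<subseteq> \<Omega>" using \<Omega>(2) that by (auto simp: subset_iff)
    have "(LINT y|lebesgue_on (ball x r). w y) = (LINT y|lebesgue. indicator (ball x r) y *\<^sub>R w y)"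
      by (rule integral_restrict_space) simp
    also have "\<dots> = (LINT y|lebesgue. indicator \<Omega> y *\<^sub>R (indicator (ball 0 r) (y - x) *\<^sub>R w y))"
      by (rule Bochner_Integration.integral_cong)
        (use sub in \<open>auto simp: indicator_def dist_norm norm_minus_commute subset_iff\<close>)
    also have "\<dots> = (LINT y|lebesgue_on \<Omega>. indicator (ball 0 r) (y - x) *\<^sub>R w y)"
      using \<Omega>(1) by (intro integral_restrict_space[symmetric]) simp
    also have "\<dots> = (LINT y|lborel. indicator (ball 0 r) y *\<^sub>R w\<^sub>0 y)"
      by (rule w\<^sub>0(5)[rule_format]) (use w\<^sub>0(1) that in \<open>auto simp: indicator_def intro!: borel_measurable_scaleR borel_measurable_indicator\<close>)
    finally show ?thesis .
  qed
  have int0: "integrable (restrict_space lborel (punctured_ball R)) u\<^sub>0"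
    using u\<^sub>0(2) by (subst integrable_restrict_space) (auto intro: integrable_mult_indicator)
  have "AE r in lborel. 0 < r \<and> r \<le> R \<longrightarrow>
      r ^ (CARD('n) - 1) *\<^sub>R (LINT \<xi>|sphere_measure. symbol A \<xi> (u\<^sub>0 (r *\<^sub>R \<xi>)))
        = (LINT y|lborel. indicator (ball 0 r) y *\<^sub>R w\<^sub>0 y)"
    by (rule sphere_mean_eq_ball_integral_borel[OF R u\<^sub>0(1,2) u\<^sub>0(3)[rule_format] w\<^sub>0(1,2) w\<^sub>0(3)[rule_format]]) (use weak in auto)
  with AE_polar[OF R u\<^sub>0(4)] polar_integral(1)[OF R u\<^sub>0(1) int0] show ?thesis
  proof eventually_elim
    case (elim r)
    show ?case
    proof
      assume r: "0 < r \<and> r \<le> R"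
      have ae: "AE \<xi> in sphere_measure. u\<^sub>0 (r *\<^sub>R \<xi>) = u (x + r *\<^sub>R \<xi>)"
        using elim(1) r AE_space by (auto elim!: AE_mp)
      then have aeA: "AE \<xi> in sphere_measure. symbol A \<xi> (u\<^sub>0 (r *\<^sub>R \<xi>)) = symbol A \<xi> (u (x + r *\<^sub>R \<xi>))"
        by eventually_elim simp
      have m: "(\<lambda>\<xi>. u\<^sub>0 (r *\<^sub>R \<xi>)) \<in> borel_measurable sphere_measure"
        by (intro borel_measurable_sphere_measure measurable_compose[OF _ u\<^sub>0(1)]) simp
      have mA: "(\<lambda>\<xi>. symbol A \<xi> (u\<^sub>0 (r *\<^sub>R \<xi>))) \<in> borel_measurable sphere_measure"
        by (rule borel_measurable_symbol_apply[OF _ m]) (rule borel_measurable_sphere_measure, simp)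
      show "integrable surface_measure (\<lambda>\<xi>. u (x + r *\<^sub>R \<xi>)) \<and>
        r ^ (CARD('n) - 1) *\<^sub>R (LINT \<xi>|surface_measure. symbol A \<xi> (u (x + r *\<^sub>R \<xi>)))
          = (LINT y|lebesgue_on (ball x r). w y)"
        unfolding surface_measure_completion completion_integral_AE_cong(1)[OF mA aeA]
          completion_integral_AE_cong(2)[OF m ae]
        using elim(2,3) r W by simp
    qed
  qed
qed

section \<open>Averaging tensors over the sphere\<close>

lemma integrable_symbol_apply:
  fixes A :: "'n::finite \<Rightarrow> 'e::euclidean_space \<Rightarrow>\<^sub>L 'f::euclidean_space"
  assumes g: "integrable surface_measure g"
  shows "integrable surface_measure (\<lambda>\<xi>. symbol A \<xi> (g \<xi>))"
proof (rule Bochner_Integration.integrable_bound)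
  show "integrable surface_measure (\<lambda>\<xi>. (\<Sum>j\<in>UNIV. norm (A j)) * norm (g \<xi>))"
    using g by (intro integrable_mult_right integrable_norm)
  show "(\<lambda>\<xi>. symbol A \<xi> (g \<xi>)) \<in> borel_measurable surface_measure"
    by (intro borel_measurable_symbol_apply borel_measurable_surface_measure borel_measurable_integrable[OF g]) simp
  show "AE \<xi> in surface_measure. norm (symbol A \<xi> (g \<xi>)) \<le> norm ((\<Sum>j\<in>UNIV. norm (A j)) * norm (g \<xi>))"
  proof (rule AE_I2)
    fix \<xi> :: "real^'n" assume "\<xi> \<in> space surface_measure"
    then have "norm (symbol A \<xi> (g \<xi>)) \<le> (\<Sum>j\<in>UNIV. norm (A j)) * norm (g \<xi>)"
      by (intro norm_symbol_apply_le) simp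
    then show "norm (symbol A \<xi> (g \<xi>)) \<le> norm ((\<Sum>j\<in>UNIV. norm (A j)) * norm (g \<xi>))" by simp
  qed
qed

lemma integrable_row_projection_apply:
  fixes A :: "'n::finite \<Rightarrow> 'e::euclidean_space \<Rightarrow>\<^sub>L 'f::euclidean_space"
  assumes g: "integrable surface_measure g"
  shows "integrable surface_measure (\<lambda>\<xi>. row_projection (symbol A \<xi>) (g \<xi>))"
proof (rule Bochner_Integration.integrable_bound[OF g])
  have "row_projection (symbol A \<xi>) (g \<xi>) = (\<Sum>b\<in>Basis. (g \<xi> \<bullet> b) *\<^sub>R row_projection (symbol A \<xi>) b)" for \<xi>
    by (subst euclidean_representation[of "g \<xi>", symmetric]) (simp add: blinfun.sum_right blinfun.scaleR_right)
  moreover have "(\<lambda>\<xi>. g \<xi> \<bullet> b) \<in> borel_measurable surface_measure" for b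
    by (rule borel_measurable_inner[OF borel_measurable_integrable[OF g]]) simp
  moreover have "(\<lambda>\<xi>. row_projection (symbol A \<xi>) b) \<in> borel_measurable surface_measure" for b
    by (rule borel_measurable_surface_measure[OF borel_measurable_row_projection_symbol])
  ultimately show "(\<lambda>\<xi>. row_projection (symbol A \<xi>) (g \<xi>)) \<in> borel_measurable surface_measure"
    by simp
  show "AE \<xi> in surface_measure. norm (row_projection (symbol A \<xi>) (g \<xi>)) \<le> norm (g \<xi>)"
    by (simp add: norm_row_projection_le)
qed

lemma tensor_apply: "tensor a \<xi> \<eta> = (\<xi> \<bullet> \<eta>) *\<^sub>R a"
  by (simp add: tensor.rep_eq)

lemma norm_tensor_le: "norm (tensor a \<xi>) \<le> norm \<xi> * norm a"
  by (rule norm_blinfun_bound)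
    (auto simp: tensor_apply mult_ac intro!: mult_left_mono order_trans[OF Cauchy_Schwarz_ineq2])

text \<open>A tensor with bounded second factor is controlled by its first factor; measurability is seen in the
  basis of elementary tensors.\<close>

lemma integrable_tensor:
  fixes b :: "real^'n \<Rightarrow> 'e::euclidean_space"
  assumes b: "integrable surface_measure b"
  shows "integrable surface_measure (\<lambda>\<xi>. tensor (b \<xi>) \<xi>)"
proof (rule Bochner_Integration.integrable_bound[OF b])
  have "tensor (b \<xi>) \<xi> = (\<Sum>k\<in>UNIV. \<Sum>i\<in>Basis. ((b \<xi> \<bullet> i) * \<xi> $ k) *\<^sub>R tensor i (axis k 1))" for \<xi>
  proof (rule blinfun_eqI)
    fix \<eta> :: "real^'n"
    have "(\<Sum>k\<in>UNIV. \<Sum>i\<in>Basis. ((b \<xi> \<bullet> i) * \<xi> $ k) *\<^sub>R tensor i (axis k 1)) \<eta>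
        = (\<Sum>k\<in>UNIV. \<Sum>i\<in>Basis. (\<xi> $ k * \<eta> $ k) *\<^sub>R ((b \<xi> \<bullet> i) *\<^sub>R i))"
      by (simp add: blinfun.sum_left blinfun.scaleR_left tensor_apply inner_axis' mult_ac)
    also have "\<dots> = tensor (b \<xi>) \<xi> \<eta>"
      unfolding scaleR_sum_right[symmetric] euclidean_representation scaleR_sum_left[symmetric]
      by (simp add: tensor_apply inner_vec_def)
    finally show "tensor (b \<xi>) \<xi> \<eta> = (\<Sum>k\<in>UNIV. \<Sum>i\<in>Basis. ((b \<xi> \<bullet> i) * \<xi> $ k) *\<^sub>R tensor i (axis k 1)) \<eta>" ..
  qed
  moreover have "(\<lambda>\<xi>::real^'n. \<xi> $ k) \<in> borel_measurable surface_measure" for k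
    by (rule borel_measurable_surface_measure) measurable
  ultimately show "(\<lambda>\<xi>. tensor (b \<xi>) \<xi>) \<in> borel_measurable surface_measure"
    using borel_measurable_integrable[OF b]
    by (auto intro!: borel_measurable_sum borel_measurable_scaleR borel_measurable_times borel_measurable_inner)
  show "AE \<xi> in surface_measure. norm (tensor (b \<xi>) \<xi>) \<le> norm (b \<xi>)"
  proof (rule AE_I2)
    fix \<xi> :: "real^'n" assume "\<xi> \<in> space surface_measure"
    then show "norm (tensor (b \<xi>) \<xi>) \<le> norm (b \<xi>)" using norm_tensor_le[of "b \<xi>" \<xi>] by simp
  qed
qed

lemma surface_second_moments:
  fixes j k :: "'n::finite"
  shows "(LINT \<xi>|surface_measure. \<xi> $ j * \<xi> $ k)
    = (if j = k then measure lebesgue (ball (0::real^'n) 1) else 0)"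
proof -
  have "(\<lambda>\<xi>::real^'n. \<xi> $ j * \<xi> $ k) \<in> borel_measurable sphere_measure"
    by (rule borel_measurable_sphere_measure) measurable
  from integral_completion[OF this] show ?thesis
    unfolding surface_measure_completion sphere_second_moments .
qed

lemma integrable_surface_components:
  fixes j k :: "'n::finite"
  shows "integrable surface_measure (\<lambda>\<xi>. \<xi> $ j * \<xi> $ k)"
proof (rule integrable_surface_measure_bounded[where K = 1])
  fix \<xi> :: "real^'n" assume "norm \<xi> = 1"
  then show "norm (\<xi> $ j * \<xi> $ k) \<le> 1"
    using component_le_norm_cart[of \<xi> j] component_le_norm_cart[of \<xi> k]
    by (simp add: abs_mult mult_le_one)
qed measurable

text \<open>Let \<open>T\<close> be the integral of the tensors, so that \<open>T e\<^sub>j\<close> is the integral of \<open>\<xi>\<^sub>j b(\<xi>)\<close>. Expanding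
  \<open>1/\<omega> \<A>(\<eta>) T \<eta>\<close> in the coordinates of \<open>\<eta>\<close>, the second moments keep only the diagonal terms
  \<open>A\<^sub>j T e\<^sub>j\<close>, and their common value \<open>\<omega>\<close> cancels the normalization.\<close>

lemma sphere_integral_tensor_mean:
  fixes A :: "'n::finite \<Rightarrow> 'e::euclidean_space \<Rightarrow>\<^sub>L 'f::euclidean_space" and b :: "real^'n \<Rightarrow> 'e"
  assumes b: "integrable surface_measure b"
  shows "(LINT \<eta>|surface_measure. symbol A \<eta>
      (((1 / measure lebesgue (ball (0::real^'n) 1)) *\<^sub>R (LINT \<xi>|surface_measure. tensor (b \<xi>) \<xi>)) \<eta>))
    = (LINT \<xi>|surface_measure. symbol A \<xi> (b \<xi>))"
proof -
  let ?\<omega> = "measure lebesgue (ball (0::real^'n) 1)"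
  define T where "T = (LINT \<xi>|surface_measure. tensor (b \<xi>) \<xi>)"
  have \<omega>: "?\<omega> \<noteq> 0" by (simp add: content_ball unit_ball_vol_pos less_imp_neq[symmetric])
  have T: "T \<eta> = (LINT \<xi>|surface_measure. (\<xi> \<bullet> \<eta>) *\<^sub>R b \<xi>)" for \<eta>
    unfolding T_def
    using integral_bounded_linear[OF blinfun.bounded_linear_left integrable_tensor[OF b], of \<eta>]
    by (simp add: tensor_apply)
  have intb: "integrable surface_measure (\<lambda>\<xi>. (\<xi> $ j) *\<^sub>R b \<xi>)" for j
    using integrable_bounded_linear[OF blinfun.bounded_linear_left integrable_tensor[OF b], of "axis j 1"]
    by (simp add: tensor_apply inner_axis)
  have Tj: "T (axis j 1) = (LINT \<xi>|surface_measure. (\<xi> $ j) *\<^sub>R b \<xi>)" for j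
    by (simp add: T inner_axis)
  have exp: "T \<eta> = (\<Sum>k\<in>UNIV. (\<eta> $ k) *\<^sub>R T (axis k 1))" for \<eta>
    by (subst basis_expansion[of \<eta>, symmetric])
      (simp add: blinfun.sum_right scalar_mult_eq_scaleR blinfun.scaleR_right)
  have "symbol A \<eta> (((1 / ?\<omega>) *\<^sub>R T) \<eta>)
      = (\<Sum>j\<in>UNIV. \<Sum>k\<in>UNIV. (\<eta> $ j * \<eta> $ k) *\<^sub>R ((1 / ?\<omega>) *\<^sub>R A j (T (axis k 1))))" for \<eta>
    by (simp add: symbol_apply exp[of \<eta>] blinfun.scaleR_left blinfun.scaleR_right blinfun.sum_right
        scaleR_sum_right) (subst sum.swap, simp add: mult.commute)
  then have "(LINT \<eta>|surface_measure. symbol A \<eta> (((1 / ?\<omega>) *\<^sub>R T) \<eta>))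
      = (LINT \<eta>|surface_measure. (\<Sum>j\<in>UNIV. \<Sum>k\<in>UNIV. (\<eta> $ j * \<eta> $ k) *\<^sub>R ((1 / ?\<omega>) *\<^sub>R A j (T (axis k 1)))))"
    by simp
  also have "\<dots> = (\<Sum>j\<in>UNIV. \<Sum>k\<in>UNIV. (LINT \<eta>|surface_measure. (\<eta> $ j * \<eta> $ k) *\<^sub>R ((1 / ?\<omega>) *\<^sub>R A j (T (axis k 1)))))"
    by (simp only: Bochner_Integration.integral_sum Bochner_Integration.integrable_sum integrable_scaleR_left integrable_surface_components)
  also have "\<dots> = (\<Sum>j\<in>UNIV. \<Sum>k\<in>UNIV. (if j = k then ?\<omega> else 0) *\<^sub>R ((1 / ?\<omega>) *\<^sub>R A j (T (axis k 1))))"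
    by (simp only: integral_scaleR_left integrable_surface_components surface_second_moments)
  also have "\<dots> = (\<Sum>j\<in>UNIV. A j (T (axis j 1)))"
  proof (rule sum.cong[OF refl])
    fix j
    have "(\<Sum>k\<in>UNIV. (if j = k then ?\<omega> else 0) *\<^sub>R ((1 / ?\<omega>) *\<^sub>R A j (T (axis k 1))))
        = (\<Sum>k\<in>UNIV. if j = k then A j (T (axis k 1)) else 0)"
      using \<omega> by (intro sum.cong) auto
    then show "(\<Sum>k\<in>UNIV. (if j = k then ?\<omega> else 0) *\<^sub>R ((1 / ?\<omega>) *\<^sub>R A j (T (axis k 1)))) = A j (T (axis j 1))"
      by simp
  qed
  also have "\<dots> = (\<Sum>j\<in>UNIV. (LINT \<xi>|surface_measure. A j ((\<xi> $ j) *\<^sub>R b \<xi>)))"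
    unfolding Tj
    by (intro sum.cong integral_bounded_linear[symmetric] intb blinfun.bounded_linear_right) auto
  also have "\<dots> = (LINT \<xi>|surface_measure. (\<Sum>j\<in>UNIV. A j ((\<xi> $ j) *\<^sub>R b \<xi>)))"
    by (intro Bochner_Integration.integral_sum[symmetric] integrable_bounded_linear[OF blinfun.bounded_linear_right intb])
  also have "\<dots> = (LINT \<xi>|surface_measure. symbol A \<xi> (b \<xi>))"
    by (simp add: symbol_apply blinfun.scaleR_right)
  finally show ?thesis unfolding T_def .
qed

section \<open>The blow up limit has vanishing symbol integral\<close>

text \<open>A null set of radii contains no interval, so removing it leaves \<open>0\<close> a limit point and limits along the
  remaining radii are unique.\<close>

lemma at_0_punctured_right_neq_bot:
  assumes "N \<in> null_sets lebesgue"
  shows "at (0::real) within {0<..} - N \<noteq> bot"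
proof
  assume "at (0::real) within {0<..} - N = bot"
  then have "eventually (\<lambda>_. False) (at (0::real) within {0<..} - N)" by simp
  then obtain d where d: "d > 0" "\<And>\<epsilon>. \<epsilon> \<in> {0<..} - N \<Longrightarrow> \<epsilon> \<noteq> 0 \<Longrightarrow> dist \<epsilon> 0 < d \<Longrightarrow> False"
    unfolding eventually_at by blast
  have "{0<..<d} \<subseteq> N"
  proof
    fix y assume "y \<in> {0<..<d}"
    then show "y \<in> N" using d(2)[of y] by (auto simp: dist_real_def)
  qed
  then have "{0<..<d} \<in> null_sets lebesgue"
    using assms by (meson null_sets_completion_subset)
  then show False using d(1) by (simp add: null_sets_def)
qed

text \<open>The value \<open>V\<close> of the integral is itself used as the dual vector: pairing with \<open>\<A>(\<xi>)\<^sup>* V\<close> turns the weak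
  limit of \<open>\<A>(\<xi>)\<^sup>+ \<A>(\<xi>) g\<close> into that of \<open>\<A>(\<xi>) g\<close>, whose integrals tend to zero, whence \<open>V \<bullet> V = 0\<close>.\<close>

lemma integral_symbol_blowup_eq_0:
  fixes A :: "'n::finite \<Rightarrow> 'e::euclidean_space \<Rightarrow>\<^sub>L 'f::euclidean_space"
    and g :: "real \<Rightarrow> real^'n \<Rightarrow> 'e"
  assumes p: "1 < p" and F: "F \<noteq> bot"
    and weak: "weakly_tendsto_Lp p surface_measure (\<lambda>\<epsilon> \<xi>. row_projection (symbol A \<xi>) (g \<epsilon> \<xi>)) v F"
    and int: "\<forall>\<^sub>F \<epsilon> in F. integrable surface_measure (g \<epsilon>)"
    and lim: "((\<lambda>\<epsilon>. LINT \<xi>|surface_measure. symbol A \<xi> (g \<epsilon> \<xi>)) \<longlongrightarrow> 0) F"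
  shows "(LINT \<xi>|surface_measure. symbol A \<xi> (v \<xi>)) = 0"
proof -
  let ?V = "LINT \<xi>|surface_measure. symbol A \<xi> (v \<xi>)"
  have v: "integrable surface_measure v"
    using weak p finite_measure_surface_measure unfolding weakly_tendsto_Lp_def
    by (intro in_Lp_integrable[of _ p]) auto
  let ?h = "\<lambda>\<xi>. adjoint (symbol A \<xi>) ?V"
  have hm: "?h \<in> borel_measurable borel"
    by (rule borel_measurable_continuous_onI[OF continuous_adjoint_symbol])
  have "in_Lp (p / (p - 1)) surface_measure ?h"
    unfolding in_Lp_def
  proof
    show "?h \<in> borel_measurable surface_measure" using hm by (rule borel_measurable_surface_measure)
    have "bounded (?h ` sphere 0 1)"
      by (intro compact_imp_bounded compact_continuous_image continuous_adjoint_symbol compact_sphere)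
    then obtain K where K: "\<forall>y\<in>?h ` sphere 0 1. norm y \<le> K"
      unfolding bounded_iff ..
    show "integrable surface_measure (\<lambda>\<xi>. norm (?h \<xi>) powr (p / (p - 1)))"
    proof (rule integrable_surface_measure_bounded)
      show "(\<lambda>\<xi>. norm (?h \<xi>) powr (p / (p - 1))) \<in> borel_measurable borel" using hm by measurable
      show "norm (norm (?h \<xi>) powr (p / (p - 1))) \<le> K powr (p / (p - 1))" if "norm \<xi> = 1" for \<xi>
        using K that p by (simp add: powr_mono2)
    qed
  qed
  then have "((\<lambda>\<epsilon>. LINT \<xi>|surface_measure. row_projection (symbol A \<xi>) (g \<epsilon> \<xi>) \<bullet> ?h \<xi>)
      \<longlongrightarrow> (LINT \<xi>|surface_measure. v \<xi> \<bullet> ?h \<xi>)) F"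
    using weak unfolding weakly_tendsto_Lp_def by blast
  moreover have "e \<bullet> ?h \<xi> = symbol A \<xi> e \<bullet> ?V" for e \<xi>
    by (rule adjoint_works[OF linear_symbol])
  ultimately have "((\<lambda>\<epsilon>. LINT \<xi>|surface_measure. symbol A \<xi> (g \<epsilon> \<xi>) \<bullet> ?V)
      \<longlongrightarrow> (LINT \<xi>|surface_measure. symbol A \<xi> (v \<xi>) \<bullet> ?V)) F"
    by simp
  moreover have "(LINT \<xi>|surface_measure. symbol A \<xi> (v \<xi>) \<bullet> ?V) = ?V \<bullet> ?V"
    using integrable_symbol_apply[OF v] by (intro integral_inner_left) auto
  moreover have "\<forall>\<^sub>F \<epsilon> in F. (LINT \<xi>|surface_measure. symbol A \<xi> (g \<epsilon> \<xi>) \<bullet> ?V)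
      = (LINT \<xi>|surface_measure. symbol A \<xi> (g \<epsilon> \<xi>)) \<bullet> ?V"
    using int by eventually_elim (intro integral_inner_left integrable_symbol_apply)
  ultimately have "((\<lambda>\<epsilon>. (LINT \<xi>|surface_measure. symbol A \<xi> (g \<epsilon> \<xi>)) \<bullet> ?V) \<longlongrightarrow> ?V \<bullet> ?V) F"
    by (simp add: Lim_transform_eventually)
  moreover have "((\<lambda>\<epsilon>. (LINT \<xi>|surface_measure. symbol A \<xi> (g \<epsilon> \<xi>)) \<bullet> ?V) \<longlongrightarrow> 0 \<bullet> ?V) F"
    by (intro tendsto_intros lim)
  ultimately have "?V \<bullet> ?V = 0 \<bullet> ?V" using F tendsto_unique by blast
  then show ?thesis by simp
qed

section \<open>The two limits\<close>

theorem lemma6p6: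
  fixes \<Omega> :: "(real^'n) set"
    and p :: real
    and A :: "'n \<Rightarrow> 'e::euclidean_space \<Rightarrow>\<^sub>L 'f::euclidean_space"
    and u v :: "real^'n \<Rightarrow> 'e"
    and w :: "real^'n \<Rightarrow> 'f"
    and x :: "real^'n"
  assumes "open \<Omega>" and "connected \<Omega>"
    and "1 < p"
    and "u \<in> weak_dom p \<Omega> A"
    and "weak_image p \<Omega> A u w"
    and "x \<in> \<Omega>"
    and "weak_spherical_blowup p A u x v"
    and "Lebesgue_point p w x"
  shows "\<exists>L.
    ess_lim_0 (\<lambda>\<epsilon>. (1 / \<epsilon>) *\<^sub>R
      (LINT \<xi>|surface_measure. symbol A \<xi> (u (x + \<epsilon> *\<^sub>R \<xi>)))) L \<and>
    ess_lim_0 (\<lambda>\<epsilon>. LINT \<eta>|surface_measure. symbol A \<eta>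
      (((1 / measure lebesgue (ball (0::real^'n) 1)) *\<^sub>R
        (LINT \<xi>|surface_measure.
          tensor ((pinv (symbol A \<xi>) o\<^sub>L symbol A \<xi>) ((1 / \<epsilon>) *\<^sub>R (u (x + \<epsilon> *\<^sub>R \<xi>) - v \<xi>))) \<xi>)) \<eta>)) L"
proof -
  let ?\<sigma> = "surface_measure :: (real^'n) measure" and ?\<omega> = "measure lebesgue (ball (0::real^'n) 1)"
  let ?M = "\<lambda>\<epsilon>. LINT \<xi>|?\<sigma>. symbol A \<xi> (u (x + \<epsilon> *\<^sub>R \<xi>))"
  obtain R where R: "0 < R" "cball x R \<subseteq> \<Omega>"
    using assms(1,6) open_contains_cball by blast
  have u: "in_Lp p (lebesgue_on \<Omega>) u" using assms(4) by (simp add: weak_dom_def)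
  have "\<Omega> \<in> sets lebesgue" using assms(1) by auto
  then have "AE r in lborel. 0 < r \<and> r \<le> R \<longrightarrow> integrable ?\<sigma> (\<lambda>\<xi>. u (x + r *\<^sub>R \<xi>)) \<and>
      r ^ (CARD('n) - 1) *\<^sub>R ?M r = (LINT y|lebesgue_on (ball x r). w y)"
    using assms(3) R u assms(5) by (intro sphere_mean_eq_ball_integral[where p = p]) auto
  then obtain N\<^sub>0 where N\<^sub>0: "N\<^sub>0 \<in> null_sets lebesgue"
    "\<And>r. r \<notin> N\<^sub>0 \<Longrightarrow> 0 < r \<Longrightarrow> r \<le> R \<Longrightarrow> integrable ?\<sigma> (\<lambda>\<xi>. u (x + r *\<^sub>R \<xi>))"
    "\<And>r. r \<notin> N\<^sub>0 \<Longrightarrow> 0 < r \<Longrightarrow> r \<le> R \<Longrightarrow>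
      r ^ (CARD('n) - 1) *\<^sub>R ?M r = (LINT y|lebesgue_on (ball x r). w y)"
    by (auto simp: eventually_ae_filter intro: null_sets_completionI)
  obtain N\<^sub>1 where N\<^sub>1: "N\<^sub>1 \<in> null_sets lebesgue"
    "weakly_tendsto_Lp p ?\<sigma> (\<lambda>\<epsilon> \<xi>. row_projection (symbol A \<xi>) (u (x + \<epsilon> *\<^sub>R \<xi>))) v (at 0 within {0<..} - N\<^sub>1)"
    using assms(7) unfolding weak_spherical_blowup_def row_projection_def by blast
  obtain c where c: "((\<lambda>r. (1 / measure lebesgue (ball x r)) *\<^sub>R (LINT y|lebesgue_on (ball x r). w y)) \<longlongrightarrow> c) (at_right 0)"
    using assms(8) unfolding Lebesgue_point_def by blast
  \<comment> \<open>\<open>N\<^sub>0\<close> contains the radii at which the divergence theorem fails, \<open>N\<^sub>1\<close> those excluded from the blow up.\<close>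
  define N where "N = N\<^sub>0 \<union> N\<^sub>1"
  define F where "F = at (0::real) within {0<..} - N"
  have N: "N \<in> null_sets lebesgue" using N\<^sub>0(1) N\<^sub>1(1) by (simp add: N_def null_sets.Un)
  have F: "F \<noteq> bot" unfolding F_def using N by (rule at_0_punctured_right_neq_bot)
  have Fle: "F \<le> at_right 0" "F \<le> at 0 within {0<..} - N\<^sub>1"
    unfolding F_def by (auto intro!: at_le simp: N_def)
  have small: "\<forall>\<^sub>F \<epsilon> in F. 0 < \<epsilon> \<and> \<epsilon> \<le> R \<and> \<epsilon> \<notin> N\<^sub>0"
    unfolding F_def eventually_at using R(1) by (intro exI[of _ R]) (auto simp: N_def dist_real_def)
  have scaled: "((\<lambda>\<epsilon>. (1 / \<epsilon>) *\<^sub>R ?M \<epsilon>) \<longlongrightarrow> ?\<omega> *\<^sub>R c) F"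
  proof -
    have "((\<lambda>\<epsilon>. ?\<omega> *\<^sub>R ((1 / measure lebesgue (ball x \<epsilon>)) *\<^sub>R (LINT y|lebesgue_on (ball x \<epsilon>). w y))) \<longlongrightarrow> ?\<omega> *\<^sub>R c) F"
      by (intro tendsto_intros tendsto_mono[OF Fle(1) c])
    moreover have "\<forall>\<^sub>F \<epsilon> in F. ?\<omega> *\<^sub>R ((1 / measure lebesgue (ball x \<epsilon>)) *\<^sub>R (LINT y|lebesgue_on (ball x \<epsilon>). w y))
        = (1 / \<epsilon>) *\<^sub>R ?M \<epsilon>"
      using small
    proof eventually_elim
      case (elim \<epsilon>)
      have vol: "unit_ball_vol (real CARD('n)) \<noteq> 0"
        using unit_ball_vol_pos[of "real CARD('n)"] by (metis less_irrefl of_nat_0_le_iff)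
      have "measure lebesgue (ball x \<epsilon>) = ?\<omega> * \<epsilon> ^ CARD('n)" and \<omega>: "?\<omega> \<noteq> 0"
        using elim by (simp_all add: content_ball vol)
      then have "?\<omega> * (1 / measure lebesgue (ball x \<epsilon>)) * \<epsilon> ^ (CARD('n) - 1) = 1 / \<epsilon>"
        using elim power_minus_mult[of "CARD('n)" \<epsilon>] by (simp add: field_simps)
      moreover have "(LINT y|lebesgue_on (ball x \<epsilon>). w y) = \<epsilon> ^ (CARD('n) - 1) *\<^sub>R ?M \<epsilon>"
        using N\<^sub>0(3) elim by simp
      ultimately show ?case by (simp add: mult.assoc)
    qed
    ultimately show ?thesis by (rule Lim_transform_eventually)
  qed
  have int: "\<forall>\<^sub>F \<epsilon> in F. integrable ?\<sigma> (\<lambda>\<xi>. u (x + \<epsilon> *\<^sub>R \<xi>))"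
    using small by eventually_elim (use N\<^sub>0(2) in auto)
  have weak: "weakly_tendsto_Lp p ?\<sigma> (\<lambda>\<epsilon> \<xi>. row_projection (symbol A \<xi>) (u (x + \<epsilon> *\<^sub>R \<xi>))) v F"
    using N\<^sub>1(2) Fle(2) unfolding weakly_tendsto_Lp_def by (auto intro: tendsto_mono simp: le_filter_def)
  have v: "integrable ?\<sigma> v"
    using weak assms(3) finite_measure_surface_measure unfolding weakly_tendsto_Lp_def
    by (intro in_Lp_integrable[of _ p]) auto
  have V: "(LINT \<xi>|?\<sigma>. symbol A \<xi> (v \<xi>)) = 0"
  proof (rule integral_symbol_blowup_eq_0[OF assms(3) F weak int])
    have "((\<lambda>\<epsilon>. \<epsilon>) \<longlongrightarrow> 0) F" unfolding F_def by (rule tendsto_ident_at)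
    from tendsto_scaleR[OF this scaled] have "((\<lambda>\<epsilon>. \<epsilon> *\<^sub>R ((1 / \<epsilon>) *\<^sub>R ?M \<epsilon>)) \<longlongrightarrow> 0) F" by simp
    moreover have "\<forall>\<^sub>F \<epsilon> in F. \<epsilon> *\<^sub>R ((1 / \<epsilon>) *\<^sub>R ?M \<epsilon>) = ?M \<epsilon>"
      using small by eventually_elim simp
    ultimately show "(?M \<longlongrightarrow> 0) F"
      by (rule Lim_transform_eventually)
  qed
  have "((\<lambda>\<epsilon>. LINT \<eta>|?\<sigma>. symbol A \<eta> (((1 / ?\<omega>) *\<^sub>R (LINT \<xi>|?\<sigma>.
      tensor (row_projection (symbol A \<xi>) ((1 / \<epsilon>) *\<^sub>R (u (x + \<epsilon> *\<^sub>R \<xi>) - v \<xi>))) \<xi>)) \<eta>)) \<longlongrightarrow> ?\<omega> *\<^sub>R c) F"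
    using scaled
  proof (rule Lim_transform_eventually)
    show "\<forall>\<^sub>F \<epsilon> in F. (1 / \<epsilon>) *\<^sub>R ?M \<epsilon> = (LINT \<eta>|?\<sigma>. symbol A \<eta> (((1 / ?\<omega>) *\<^sub>R (LINT \<xi>|?\<sigma>.
      tensor (row_projection (symbol A \<xi>) ((1 / \<epsilon>) *\<^sub>R (u (x + \<epsilon> *\<^sub>R \<xi>) - v \<xi>))) \<xi>)) \<eta>))"
      using int
    proof eventually_elim
      case (elim \<epsilon>)
      have "integrable ?\<sigma> (\<lambda>\<xi>. (1 / \<epsilon>) *\<^sub>R (u (x + \<epsilon> *\<^sub>R \<xi>) - v \<xi>))"
        using elim v by (intro integrable_scaleR_right Bochner_Integration.integrable_diff)
      from sphere_integral_tensor_mean[OF integrable_row_projection_apply[OF this], of A A]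
      have "(LINT \<eta>|?\<sigma>. symbol A \<eta> (((1 / ?\<omega>) *\<^sub>R (LINT \<xi>|?\<sigma>.
          tensor (row_projection (symbol A \<xi>) ((1 / \<epsilon>) *\<^sub>R (u (x + \<epsilon> *\<^sub>R \<xi>) - v \<xi>))) \<xi>)) \<eta>))
        = (LINT \<xi>|?\<sigma>. (1 / \<epsilon>) *\<^sub>R (symbol A \<xi> (u (x + \<epsilon> *\<^sub>R \<xi>)) - symbol A \<xi> (v \<xi>)))"
        unfolding apply_row_projection by (simp only: blinfun.scaleR_right blinfun.diff_right)
      also have "\<dots> = (1 / \<epsilon>) *\<^sub>R (?M \<epsilon> - (LINT \<xi>|?\<sigma>. symbol A \<xi> (v \<xi>)))"
        unfolding integral_scaleR_right
          Bochner_Integration.integral_diff[OF integrable_symbol_apply[OF elim] integrable_symbol_apply[OF v]] ..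
      finally show ?case using V by simp
    qed
  qed
  then show ?thesis
    using scaled N unfolding ess_lim_0_def F_def row_projection_def by blast
qed

end
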